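(* Let $0<a,b<1$, $0<\eta<1$, and let $f=f(N)$ be integers with $1\le f<N$ and $f\sim\eta N$ as $N\to\infty$. Let $\mathbf X=\mathbf X^N$ be the two-strata persistent gambler's ruin process described in the context, started at a fixed integer $m$ independent of $N$. Let $\mathcal L_N$ be the last visit time, and let $\mathcal R_N,\mathcal V_N,\mathcal M_N$ be as defined in the context. Put $$\mathcal X_N:=\frac1N\Big(\mathcal L_N-\frac{2-a-b}{(1-a)(1-b)}\mathcal R_N+\frac{1}{(1-a)(1-b)}\mathcal V_N-\frac{a(b-a)}{(1-a)(1-b)}\mathcal M_N\Big).$$ Let $\sigma_1=\sqrt{a+b^2-2ab}$, $\sigma_2=\sqrt{b+a^2-2ab}$, $\kappa_1=\frac{\eta\sigma_1}{1-b}$, $\kappa_2=\frac{(1-\eta)\sigma_2}{1-a}$. Define $\hat\varphi(0)=1$ and, for $t\ne0$, $$\frac{(b\kappa_1\sigma_2+a\kappa_2\sigma_1)t}{\hat\varphi(t)}=a\sigma_1\cosh(\kappa_1t)\sinh(\kappa_2t)+b\sigma_2\sinh(\kappa_1t)\cosh(\kappa_2t)+i(b-a)^2\sinh(\kappa_1t)\sinh(\kappa_2t),$$ and define $\hat\psi$ by $$\frac{ab\sigma_1\sigma_2}{\hat\psi(t)}=ab\sigma_1\sigma_2\cosh(\kappa_1t)\cosh(\kappa_2t)+a^2\sigma_1^2\sinh(\kappa_1t)\sinh(\kappa_2t)+ia\sigma_1(b-a)^2\cosh(\kappa_1t)\sinh(\kappa_2t).$$ Then for every real $t$, $\lim_{N\to\infty}E\{e^{it\mathcal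 X_N}\}=\hat\psi(t)/\hat\varphi(t)$.
   Context: Fix $0<a,b<1$ and integers $1\le f<N$. The gambler's ruin process $(\mathbf X_j)_{j\ge0}$ takes values in $\mathbb Z\cap[-N,N]$, starts at $\mathbf X_0=m$, $|m|<N$, and has increments $\varepsilon_j=\mathbf X_j-\mathbf X_{j-1}\in\{\pm1\}$ with $P(\varepsilon_1=\pm1)=\frac12$ and, for $j\ge1$, $P(\varepsilon_{j+1}=1\mid\varepsilon_j=1,|\mathbf X_j|=k)=P(\varepsilon_{j+1}=-1\mid\varepsilon_j=-1,|\mathbf X_j|=k)=a_k$ (reversal with probability $1-a_k$), where $a_k=a$ for $0\le k\le f-1$ and $a_k=b$ for $f\le k<N$; it is stopped at the first time $j$ with $|\mathbf X_j|=N$. For a nearest-neighbour path, a run is a maximal block of consecutive steps all $+1$ or all $-1$; a short run is a run consisting of one step. The last visit is $\mathcal L_N:=\max\{j\ge0:j=0\text{ or }\mathbf X_j=0\}$. The excursions of the absolute value process $(|\mathbf X_j|)$ until the last visit are the path segments of $(|\mathbf X_j|)$ between two consecutive times at which $\mathbf X_j=0$, up to time $\mathcal L_N$. $\mathcal R_N$ (resp. $\mathcal V_N$) is the total, summed over these excursions, of the number of runs (resp. short runs) in each excursion, and $\mathcal M_N$ is the number of these excursions (each has height at most $N-1$). *)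

theory Defs
  imports "HOL-Analysis.Analysis" "HOL-Library.Landau_Symbols"
begin

text \<open>A path of the gambler's ruin process is encoded by the list es of its increments
  (eps_1, ..., eps_n), each in {-1,1}; the position at time j is m + eps_1 + ... + eps_j.\<close>

definition gr_pos :: "int \<Rightarrow> int list \<Rightarrow> nat \<Rightarrow> int" where
  "gr_pos m es j = m + sum_list (take j es)"

definition gr_coef :: "real \<Rightarrow> real \<Rightarrow> nat \<Rightarrow> int \<Rightarrow> real" where
  "gr_coef a b f k = (if k < int f then a else b)"

definition gr_prob :: "real \<Rightarrow> real \<Rightarrow> nat \<Rightarrow> int \<Rightarrow> int list \<Rightarrow> real" where
  "gr_prob a b f m es =
     (if es = [] then 1 else
       (1/2) * (\<Prod>j\<in>{1..<length es}.
          (if es ! j = es ! (j - 1) then gr_coef a b f \<bar>gr_pos m es j\<bar>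
           else 1 - gr_coef a b f \<bar>gr_pos m es j\<bar>)))"

definition gr_stopped :: "nat \<Rightarrow> int \<Rightarrow> int list \<Rightarrow> bool" where
  "gr_stopped N m es \<longleftrightarrow> set es \<subseteq> {-1, 1}
      \<and> (\<forall>j < length es. \<bar>gr_pos m es j\<bar> < int N)
      \<and> \<bar>gr_pos m es (length es)\<bar> = int N"

definition gr_last :: "int \<Rightarrow> int list \<Rightarrow> nat" where
  "gr_last m es = Max {j. j \<le> length es \<and> (j = 0 \<or> gr_pos m es j = 0)}"

definition gr_zeros :: "int \<Rightarrow> int list \<Rightarrow> nat list" where
  "gr_zeros m es = filter (\<lambda>j. gr_pos m es j = 0) [0..<Suc (length es)]"

definition gr_excursions :: "int \<Rightarrow> int list \<Rightarrow> (nat \<times> nat) list" where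
  "gr_excursions m es = zip (gr_zeros m es) (tl (gr_zeros m es))"

definition gr_exc_steps :: "int \<Rightarrow> int list \<Rightarrow> nat \<Rightarrow> nat \<Rightarrow> int list" where
  "gr_exc_steps m es s s' =
     map (\<lambda>j. \<bar>gr_pos m es (Suc j)\<bar> - \<bar>gr_pos m es j\<bar>) [s..<s']"

definition num_runs :: "int list \<Rightarrow> nat" where
  "num_runs ds = length (remdups_adj ds)"

definition num_short_runs :: "int list \<Rightarrow> nat" where
  "num_short_runs ds = card {i. i < length ds
       \<and> (i = 0 \<or> ds ! (i - 1) \<noteq> ds ! i)
       \<and> (Suc i = length ds \<or> ds ! Suc i \<noteq> ds ! i)}"

definition gr_R :: "int \<Rightarrow> int list \<Rightarrow> nat" where
  "gr_R m es = sum_list (map (\<lambda>(s, s'). num_runs (gr_exc_steps m es s s')) (gr_excursions m es))"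

definition gr_V :: "int \<Rightarrow> int list \<Rightarrow> nat" where
  "gr_V m es = sum_list (map (\<lambda>(s, s'). num_short_runs (gr_exc_steps m es s s')) (gr_excursions m es))"

definition gr_M :: "int \<Rightarrow> int list \<Rightarrow> nat" where
  "gr_M m es = length (gr_excursions m es)"

definition gr_stat :: "real \<Rightarrow> real \<Rightarrow> nat \<Rightarrow> int \<Rightarrow> int list \<Rightarrow> real" where
  "gr_stat a b N m es = (1 / real N) *
     (real (gr_last m es)
      - (2 - a - b) / ((1 - a) * (1 - b)) * real (gr_R m es)
      + 1 / ((1 - a) * (1 - b)) * real (gr_V m es)
      - a * (b - a) / ((1 - a) * (1 - b)) * real (gr_M m es))"

definition gr_charfun :: "real \<Rightarrow> real \<Rightarrow> nat \<Rightarrow> nat \<Rightarrow> int \<Rightarrow> real \<Rightarrow> complex" where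
  "gr_charfun a b f N m t =
     infsum (\<lambda>es. complex_of_real (gr_prob a b f m es) * exp (\<i> * complex_of_real (t * gr_stat a b N m es)))
            {es. gr_stopped N m es}"

definition sig1 :: "real \<Rightarrow> real \<Rightarrow> real" where "sig1 a b = sqrt (a + b^2 - 2*a*b)"
definition sig2 :: "real \<Rightarrow> real \<Rightarrow> real" where "sig2 a b = sqrt (b + a^2 - 2*a*b)"
definition kap1 :: "real \<Rightarrow> real \<Rightarrow> real \<Rightarrow> real" where "kap1 a b \<eta> = \<eta> * sig1 a b / (1 - b)"
definition kap2 :: "real \<Rightarrow> real \<Rightarrow> real \<Rightarrow> real" where "kap2 a b \<eta> = (1 - \<eta>) * sig2 a b / (1 - a)"

definition phi_hat :: "real \<Rightarrow> real \<Rightarrow> real \<Rightarrow> real \<Rightarrow> complex" where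
  "phi_hat a b \<eta> t =
    (if t = 0 then 1 else
      complex_of_real ((b * kap1 a b \<eta> * sig2 a b + a * kap2 a b \<eta> * sig1 a b) * t) /
      (complex_of_real (a * sig1 a b * cosh (kap1 a b \<eta> * t) * sinh (kap2 a b \<eta> * t)
                        + b * sig2 a b * sinh (kap1 a b \<eta> * t) * cosh (kap2 a b \<eta> * t))
       + \<i> * complex_of_real ((b - a)^2 * sinh (kap1 a b \<eta> * t) * sinh (kap2 a b \<eta> * t))))"

definition psi_hat :: "real \<Rightarrow> real \<Rightarrow> real \<Rightarrow> real \<Rightarrow> complex" where
  "psi_hat a b \<eta> t =
      complex_of_real (a * b * sig1 a b * sig2 a b) /
      (complex_of_real (a * b * sig1 a b * sig2 a b * cosh (kap1 a b \<eta> * t) * cosh (kap2 a b \<eta> * t)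
                        + a^2 * (sig1 a b)^2 * sinh (kap1 a b \<eta> * t) * sinh (kap2 a b \<eta> * t))
       + \<i> * complex_of_real (a * sig1 a b * (b - a)^2 * cosh (kap1 a b \<eta> * t) * sinh (kap2 a b \<eta> * t)))"

end

(* Give every path the complex weight exp(i t X_N).  The weighted sums over the future of a path,
   indexed by the level, the direction of the last step and whether that step opened a run, satisfy
   a linear first-step recursion.  On the vector attached to the edge {k, k+1} it is a two-by-two
   transfer matrix; after the change of variables (p, q) -> (p, N (p - q)) this matrix is the
   identity plus L/N plus o(1/N), because the centering constants cancel the first-order drift in
   each stratum.  Products over a stratum therefore converge to exp(L u), with hyperbolic entries,
   while the two levels next to the interface f contribute a jump, the only source of the imaginary
   parts.  Closing the recursion at 0 expresses the characteristic function as
   (N Z) B / (N (B - omega U)), where Z is the probability that an excursion reaches N, and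
   N Z, B and N (B - omega U) all converge.  For a start at m <> 0 the walk returns to 0 in o(N)
   steps with probability tending to 1. *)
theory Submission
  imports Defs
begin

section \<open>Path statistics as recursive functions of the increments\<close>

text \<open>The centering constants are forced. Let r, bt, g be the coefficients of runs, short runs
  and excursions. Absence of drift in a stratum with persistence \<alpha> means r = (1 - \<alpha>)
  bt + 1 / (1 - \<alpha>); for a different from b the two strata determine r and bt. Then g is fixed
  by the demand that a return to 0 contributes no first-order term. The obstacle is the count of
  short runs: a reversal ends a short run only if the preceding step opened its run, so every level
  carries four unknowns. The values for a step that opened its run and for one that did not differ
  only through an immediate reversal. This eliminates two unknowns, but brings the coefficients of k
  + 1 and k - 1 into the equations at k. Hence exactly two matrices, at k = f and k = f - 1, mix a
  and b. Inside excursions the recursion is homogeneous, so going down from N it yields the vectors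
  only up to one unknown scalar. The equations at level 1 eliminate it. The difference p - q acts as
  a flux across an edge and is smaller than p by a factor 1/N, whence the scaling by N.\<close>

lemma gr_pos_0 [simp]: "gr_pos m es 0 = m"
  by (simp add: gr_pos_def)

lemma gr_pos_Cons_Suc [simp]: "gr_pos m (e # es) (Suc j) = gr_pos (m + e) es j"
  by (simp add: gr_pos_def)

lemma gr_pos_uminus: "gr_pos (- m) (map uminus es) j = - gr_pos m es j"
proof -
  have "sum_list (map uminus xs) = - sum_list xs" for xs :: "int list"
    by (induction xs) auto
  then show ?thesis
    by (simp add: gr_pos_def take_map)
qed

definition gr_hits :: "int \<Rightarrow> int list \<Rightarrow> bool" where
  "gr_hits m es \<longleftrightarrow> gr_zeros m es \<noteq> []"

lemma gr_zeros_Nil: "gr_zeros m [] = (if m = 0 then [0] else [])"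
  by (simp add: gr_zeros_def)

lemma gr_zeros_Cons:
  "gr_zeros m (e # es) = (if m = 0 then [0] else []) @ map Suc (gr_zeros (m + e) es)"
proof -
  have "[0..<Suc (length (e # es))] = 0 # map Suc [0..<Suc (length es)]"
    by (simp add: map_Suc_upt upt_conv_Cons del: upt_Suc)
  then show ?thesis
    by (simp add: gr_zeros_def filter_map comp_def del: upt_Suc)
qed

lemma gr_hits_Nil [simp]: "gr_hits m [] \<longleftrightarrow> m = 0"
  by (simp add: gr_hits_def gr_zeros_Nil)

lemma gr_hits_Cons [simp]: "gr_hits m (e # es) \<longleftrightarrow> m = 0 \<or> gr_hits (m + e) es"
  by (simp add: gr_hits_def gr_zeros_Cons)

lemma gr_hits_0 [simp]: "gr_hits 0 es"
  by (cases es) auto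

lemma gr_last_Max: "gr_last m es = Max (insert 0 (set (gr_zeros m es)))"
proof -
  have "{j. j \<le> length es \<and> (j = 0 \<or> gr_pos m es j = 0)} = insert 0 (set (gr_zeros m es))"
    by (auto simp: gr_zeros_def simp del: upt_Suc)
  then show ?thesis by (simp add: gr_last_def)
qed

lemma gr_last_Cons:
  "gr_last m (e # es) = (if gr_hits (m + e) es then Suc (gr_last (m + e) es) else 0)"
proof -
  let ?Z = "set (gr_zeros (m + e) es)"
  have "gr_last m (e # es) = Max (insert 0 (Suc ` ?Z))"
    unfolding gr_last_Max gr_zeros_Cons by (cases "m = 0") simp_all
  moreover have "Max (insert 0 (Suc ` ?Z)) = Suc (Max (insert 0 ?Z))" if "?Z \<noteq> {}"
    using that mono_Max_commute[of Suc ?Z] by (simp add: mono_def)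
  ultimately show ?thesis
    by (auto simp: gr_last_Max gr_hits_def)
qed

lemma gr_exc_steps_Cons_Suc:
  "gr_exc_steps m (e # es) (Suc s) (Suc s') = gr_exc_steps (m + e) es s s'"
  unfolding gr_exc_steps_def map_Suc_upt[symmetric] by simp

lemma gr_exc_steps_Cons_0:
  "gr_exc_steps m (e # es) 0 (Suc s') = (\<bar>m + e\<bar> - \<bar>m\<bar>) # gr_exc_steps (m + e) es 0 s'"
  using gr_exc_steps_Cons_Suc[of m e es 0 s']
  by (simp add: gr_exc_steps_def upt_conv_Cons del: upt_Suc)

lemma gr_excursions_Cons:
  "gr_excursions m (e # es) =
     (if m = 0 \<and> gr_hits (m + e) es then [(0, Suc (hd (gr_zeros (m + e) es)))] else [])
     @ map (map_prod Suc Suc) (gr_excursions (m + e) es)"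
proof -
  have "zip (Suc z # map Suc zs) (map Suc zs) = map (map_prod Suc Suc) (zip (z # zs) zs)" for z zs
    using zip_map_map[of Suc "z # zs" Suc zs] unfolding map_prod_def by simp
  then show ?thesis
    by (cases "gr_zeros (m + e) es")
       (auto simp: gr_excursions_def gr_zeros_Cons gr_hits_def)
qed

lemma gr_R_Cons:
  "gr_R m (e # es) =
     (if m = 0 \<and> gr_hits (m + e) es
      then num_runs ((\<bar>m + e\<bar> - \<bar>m\<bar>) # gr_exc_steps (m + e) es 0 (hd (gr_zeros (m + e) es))) else 0)
     + gr_R (m + e) es"
  by (auto simp: gr_R_def gr_excursions_Cons comp_def map_prod_def case_prod_unfold
      gr_exc_steps_Cons_Suc gr_exc_steps_Cons_0)

lemma gr_V_Cons:
  "gr_V m (e # es) =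
     (if m = 0 \<and> gr_hits (m + e) es
      then num_short_runs ((\<bar>m + e\<bar> - \<bar>m\<bar>) # gr_exc_steps (m + e) es 0 (hd (gr_zeros (m + e) es))) else 0)
     + gr_V (m + e) es"
  by (auto simp: gr_V_def gr_excursions_Cons comp_def map_prod_def case_prod_unfold
      gr_exc_steps_Cons_Suc gr_exc_steps_Cons_0)

lemma gr_M_Cons:
  "gr_M m (e # es) = of_bool (m = 0 \<and> gr_hits (m + e) es) + gr_M (m + e) es"
  by (auto simp: gr_M_def gr_excursions_Cons)

lemma no_excursions:
  assumes "\<not> gr_hits m es"
  shows "gr_R m es = 0" "gr_V m es = 0" "gr_M m es = 0"
  using assms by (simp_all add: gr_R_def gr_V_def gr_M_def gr_excursions_def gr_hits_def)

section \<open>Runs and short runs when a step is prepended\<close>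

lemma num_runs_Cons_Cons: "num_runs (d # d' # ds) = of_bool (d \<noteq> d') + num_runs (d' # ds)"
  by (auto simp: num_runs_def)

text \<open>The flag tells whether the first entry of the list is the first step of its run.\<close>

definition short_runs_from :: "bool \<Rightarrow> int list \<Rightarrow> nat" where
  "short_runs_from fr ds = card {i. i < length ds
       \<and> (if i = 0 then fr else ds ! (i - 1) \<noteq> ds ! i)
       \<and> (Suc i = length ds \<or> ds ! Suc i \<noteq> ds ! i)}"

lemma num_short_runs_eq: "num_short_runs = short_runs_from True"
  by (rule ext) (auto simp: num_short_runs_def short_runs_from_def intro!: arg_cong[where f = card])

lemma short_runs_from_single: "short_runs_from fr [d] = of_bool fr"
proof -
  have "{i. i < length [d] \<and> (if i = 0 then fr else [d] ! (i - 1) \<noteq> [d] ! i)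
       \<and> (Suc i = length [d] \<or> [d] ! Suc i \<noteq> [d] ! i)} = (if fr then {0} else {})"
    by auto
  then show ?thesis unfolding short_runs_from_def by simp
qed

text \<open>The first entry is a short run exactly if it opened its run and the run ends at once.
  All other positions are positions of the tail, whose flag records whether \<open>d'\<close> opens
  a new run.\<close>

lemma short_runs_from_Cons_Cons:
  "short_runs_from fr (d # d' # ds) = of_bool (fr \<and> d \<noteq> d') + short_runs_from (d \<noteq> d') (d' # ds)"
proof -
  define I where "I fr ds = {i. i < length ds \<and> (if i = 0 then fr else ds ! (i - 1) \<noteq> ds ! i)
       \<and> (Suc i = length ds \<or> ds ! Suc i \<noteq> ds ! i)}" for fr and ds :: "int list"
  have "0 \<in> I fr (d # d' # ds) \<longleftrightarrow> fr \<and> d \<noteq> d'"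
    by (auto simp: I_def)
  moreover have "Suc i \<in> I fr (d # d' # ds) \<longleftrightarrow> i \<in> I (d \<noteq> d') (d' # ds)" for i
    by (cases i) (auto simp: I_def)
  ultimately have "(i \<in> I fr (d # d' # ds)) =
      (i \<in> (if fr \<and> d \<noteq> d' then {0} else {}) \<union> Suc ` I (d \<noteq> d') (d' # ds))" for i
    by (cases i) auto
  then have "I fr (d # d' # ds) = (if fr \<and> d \<noteq> d' then {0} else {}) \<union> Suc ` I (d \<noteq> d') (d' # ds)"
    by blast
  moreover have "finite (I fr' ds')" for fr' ds'
    unfolding I_def by simp
  ultimately have "card (I fr (d # d' # ds)) = of_bool (fr \<and> d \<noteq> d') + card (I (d \<noteq> d') (d' # ds))"
    by (auto simp: card_image card_insert_if)
  then show ?thesis by (simp add: short_runs_from_def I_def)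
qed

text \<open>\<open>gr_run_lin\<close> is the part of the statistic still to be collected inside an excursion, when the
  previous step of the absolute value was \<open>d\<close> and the flag tells whether \<open>d\<close> started a run.  A run
  is charged when it starts, the correction for a short run when it ends.\<close>

definition gr_lin :: "real \<Rightarrow> real \<Rightarrow> real \<Rightarrow> int \<Rightarrow> int list \<Rightarrow> real" where
  "gr_lin r b g m es =
     real (gr_last m es) - r * real (gr_R m es) + b * real (gr_V m es) - g * real (gr_M m es)"

definition gr_run_lin ::
    "real \<Rightarrow> real \<Rightarrow> real \<Rightarrow> bool \<Rightarrow> int \<Rightarrow> int \<Rightarrow> int list \<Rightarrow> real" where
  "gr_run_lin r b g fr d m es =
    (if gr_hits m es then
       (let ds = d # gr_exc_steps m es 0 (hd (gr_zeros m es)) in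
         gr_lin r b g m es - r * (real (num_runs ds) - 1) + b * real (short_runs_from fr ds) - g)
     else 0)"

text \<open>Steps before the first visit to 0 belong to no excursion, so such a step affects only
  the last visit time. With no visit ahead nothing is collected at all.\<close>

lemma gr_lin_Cons:
  assumes "m \<noteq> 0"
  shows "gr_lin r b g m (e # es) = (if gr_hits (m + e) es then 1 + gr_lin r b g (m + e) es else 0)"
  using assms by (auto simp: gr_lin_def gr_last_Cons gr_R_Cons gr_V_Cons gr_M_Cons no_excursions)

text \<open>The absolute value rises for either sign of \<open>e\<close>, so an excursion begins
  with a fresh upward run: one unit of time and one run charge. Without a return to 0 the present
  visit is the last one.\<close>

lemma gr_lin_zero_Cons:
  assumes "\<bar>e\<bar> = 1"
  shows "gr_lin r b g 0 (e # es) =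
    (if gr_hits e es then 1 - r + gr_run_lin r b g True 1 e es else 0)"
  using assms
  by (auto simp: gr_lin_def gr_run_lin_def Let_def gr_last_Cons gr_R_Cons gr_V_Cons gr_M_Cons
      no_excursions num_short_runs_eq algebra_simps)

text \<open>Arrival at 0 closes the current run, which is short exactly when its last step also
  opened it, and the charge for the completed excursion falls due.\<close>

lemma gr_run_lin_zero:
  "gr_run_lin r b g fr d 0 es = gr_lin r b g 0 es + b * of_bool fr - g"
proof -
  have "hd (gr_zeros 0 es) = 0"
    by (cases es) (auto simp: gr_zeros_Cons gr_zeros_Nil)
  then show ?thesis
    by (simp add: gr_run_lin_def gr_exc_steps_def num_runs_def short_runs_from_single)
qed

lemma gr_run_lin_Cons:
  fixes m e :: int
  assumes "m \<noteq> 0"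
  defines "d' \<equiv> \<bar>m + e\<bar> - \<bar>m\<bar>"
  shows "gr_run_lin r b g fr d m (e # es) =
    (if gr_hits (m + e) es then
       1 - r * of_bool (d \<noteq> d') + b * of_bool (fr \<and> d \<noteq> d') + gr_run_lin r b g (d \<noteq> d') d' (m + e) es
     else 0)"
proof (cases "gr_hits (m + e) es")
  case True
  then have "hd (gr_zeros m (e # es)) = Suc (hd (gr_zeros (m + e) es))"
    using assms by (auto simp: gr_zeros_Cons gr_hits_def hd_map)
  then show ?thesis
    using True assms
    by (auto simp: gr_run_lin_def Let_def gr_lin_Cons gr_exc_steps_Cons_0 num_runs_Cons_Cons
        short_runs_from_Cons_Cons algebra_simps)
qed (use assms in \<open>auto simp: gr_run_lin_def\<close>)

lemma gr_zeros_uminus: "gr_zeros (- m) (map uminus es) = gr_zeros m es"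
  by (simp add: gr_zeros_def gr_pos_uminus del: upt_Suc)

lemma gr_hits_uminus: "gr_hits (- m) (map uminus es) = gr_hits m es"
  by (simp add: gr_hits_def gr_zeros_uminus)

lemma gr_exc_steps_uminus: "gr_exc_steps (- m) (map uminus es) s s' = gr_exc_steps m es s s'"
  by (simp add: gr_exc_steps_def gr_pos_uminus)

lemma gr_lin_uminus: "gr_lin r b g (- m) (map uminus es) = gr_lin r b g m es"
  by (simp add: gr_lin_def gr_last_Max gr_R_def gr_V_def gr_M_def gr_excursions_def gr_zeros_uminus
      gr_exc_steps_uminus)

lemma gr_run_lin_uminus: "gr_run_lin r b g fr d (- m) (map uminus es) = gr_run_lin r b g fr d m es"
  by (simp add: gr_run_lin_def gr_hits_uminus gr_zeros_uminus gr_lin_uminus gr_exc_steps_uminus)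

section \<open>Sums over stopped paths\<close>

lemma gr_stopped_Nil [simp]: "gr_stopped N m [] \<longleftrightarrow> \<bar>m\<bar> = int N"
  by (simp add: gr_stopped_def)

lemma gr_stopped_Cons [simp]:
  "gr_stopped N m (e # es) \<longleftrightarrow> \<bar>m\<bar> < int N \<and> (e = 1 \<or> e = -1) \<and> gr_stopped N (m + e) es"
  by (auto simp: gr_stopped_def All_less_Suc2)

lemma gr_stopped_uminus: "gr_stopped N (- m) (map uminus es) \<longleftrightarrow> gr_stopped N m es"
proof -
  have "uminus ` A \<subseteq> {-1, 1} \<longleftrightarrow> A \<subseteq> {-1, 1}" for A :: "int set"
    by (auto simp: image_subset_iff minus_equation_iff)
  then show ?thesis
    by (simp add: gr_stopped_def gr_pos_uminus)
qed

text \<open>Conditional probability of the remaining increments after a step \<open>e0\<close> that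
  arrived at \<open>m\<close>. Passing the last increment along replaces the backward lookup in
  \<open>gr_prob\<close> and makes the recursion Markovian.\<close>

primrec gr_cprob :: "real \<Rightarrow> real \<Rightarrow> nat \<Rightarrow> int \<Rightarrow> int \<Rightarrow> int list \<Rightarrow> real" where
  "gr_cprob a b f e0 m [] = 1"
| "gr_cprob a b f e0 m (e # es) =
     (if e = e0 then gr_coef a b f \<bar>m\<bar> else 1 - gr_coef a b f \<bar>m\<bar>) * gr_cprob a b f e (m + e) es"

lemma gr_prob_Cons: "gr_prob a b f m (e # es) = 1/2 * gr_cprob a b f e (m + e) es"
proof -
  have "(\<Prod>j\<in>{1..<Suc (length es)}.
          (if (e # es) ! j = (e # es) ! (j - 1) then gr_coef a b f \<bar>gr_pos m (e # es) j\<bar>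
           else 1 - gr_coef a b f \<bar>gr_pos m (e # es) j\<bar>)) = gr_cprob a b f e (m + e) es"
  proof (induction es arbitrary: e m)
    case (Cons e' es)
    let ?F = "\<lambda>j. (if (e # e' # es) ! j = (e # e' # es) ! (j - 1)
                    then gr_coef a b f \<bar>gr_pos m (e # e' # es) j\<bar>
                    else 1 - gr_coef a b f \<bar>gr_pos m (e # e' # es) j\<bar>)"
    have "(\<Prod>j\<in>{1..<Suc (length (e' # es))}. ?F j) = ?F 1 * (\<Prod>j\<in>{1..<Suc (length es)}. ?F (Suc j))"
      by (simp add: prod.atLeast_Suc_lessThan prod.atLeast_Suc_lessThan_Suc_shift del: prod.op_ivl_Suc)
    also have "(\<Prod>j\<in>{1..<Suc (length es)}. ?F (Suc j)) = gr_cprob a b f e' (m + e + e') es"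
      unfolding Cons.IH[symmetric] by (intro prod.cong) (auto simp: nth_Cons')
    finally show ?case by simp
  qed simp
  then show ?thesis by (simp add: gr_prob_def)
qed

lemma gr_cprob_uminus: "gr_cprob a b f (- e) (- m) (map uminus es) = gr_cprob a b f e m es"
proof (induction es arbitrary: e m)
  case (Cons e' es)
  have "\<bar>- m - e'\<bar> = \<bar>m + e'\<bar>" by simp
  then show ?case using Cons[of e' "m + e'"] by (simp add: algebra_simps)
qed simp

lemma gr_prob_uminus: "gr_prob a b f (- m) (map uminus es) = gr_prob a b f m es"
proof (cases es)
  case (Cons e es')
  then show ?thesis
    using gr_cprob_uminus[of a b f e "m + e" es'] by (simp add: gr_prob_Cons)
qed (simp add: gr_prob_def)

lemma gr_stat_eq:
  "gr_stat a b N m es = gr_lin ((2 - a - b) / ((1 - a) * (1 - b))) (1 / ((1 - a) * (1 - b)))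
      (a * (b - a) / ((1 - a) * (1 - b))) m es / real N"
  by (simp add: gr_stat_def gr_lin_def)

lemma bij_betw_stopped_uminus:
  "bij_betw (map uminus) {es. gr_stopped N m es} {es. gr_stopped N (- m) es}"
proof (rule bij_betw_byWitness[where f' = "map uminus"])
  show "map uminus ` {es. gr_stopped N (- m) es} \<subseteq> {es. gr_stopped N m es}"
    using gr_stopped_uminus[of N "- m"] by auto
qed (auto simp: gr_stopped_uminus comp_def)

text \<open>The probability depends on the absolute values and on equality of consecutive
  increments, the statistic on the absolute values only. Reflection thus reduces negative starting
  points to positive ones.\<close>

lemma gr_charfun_uminus: "gr_charfun a b f N (- m) t = gr_charfun a b f N m t"
  unfolding gr_charfun_def
  by (subst infsum_reindex_bij_betw[OF bij_betw_stopped_uminus[of N m], symmetric])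
     (simp add: gr_prob_uminus gr_stat_eq gr_lin_uminus)

section \<open>Conditional expectations over the future of a path\<close>

locale ruin =
  fixes a b :: real and f N :: nat
  assumes ab: "0 < a" "a < 1" "0 < b" "b < 1"
begin

abbreviation coef :: "int \<Rightarrow> real" where "coef k \<equiv> gr_coef a b f k"

lemma coef_bounds: "0 < coef k" "coef k < 1"
  using ab by (auto simp: gr_coef_def)

abbreviation stopped :: "int \<Rightarrow> int list set" where "stopped m \<equiv> {es. gr_stopped N m es}"

abbreviation cprob :: "int \<Rightarrow> int \<Rightarrow> int list \<Rightarrow> real" where "cprob \<equiv> gr_cprob a b f"

lemma cprob_nonneg: "0 \<le> cprob e m es"
proof (induction es arbitrary: e m)
  case (Cons e' es)
  then show ?case using coef_bounds[of "\<bar>m\<bar>"] by auto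
qed simp

lemma stopped_rec:
  assumes "\<bar>m\<bar> < int N"
  shows "stopped m = (#) 1 ` stopped (m + 1) \<union> (#) (-1) ` stopped (m - 1)"
proof (rule set_eqI)
  fix es
  show "es \<in> stopped m \<longleftrightarrow> es \<in> (#) 1 ` stopped (m + 1) \<union> (#) (-1) ` stopped (m - 1)"
    using assms by (cases es) auto
qed

lemma stopped_exit: "\<bar>m\<bar> = int N \<Longrightarrow> stopped m = {[]}"
proof (rule set_eqI)
  fix es assume "\<bar>m\<bar> = int N"
  then show "es \<in> stopped m \<longleftrightarrow> es \<in> {[]}" by (cases es) auto
qed

lemma stopped_empty: "\<bar>m\<bar> > int N \<Longrightarrow> stopped m = {}"
proof (rule set_eqI)
  fix es assume "\<bar>m\<bar> > int N"
  then show "es \<in> stopped m \<longleftrightarrow> es \<in> {}" by (cases es) auto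
qed

text \<open>Splitting by the first increment gives two families of tails, weighted by conditional
  probabilities that add up to one; the induction runs over a bound for the path lengths. This is
  the source of all summability below.\<close>

lemma cprob_sum_le:
  assumes "finite B" "B \<subseteq> stopped m" "e = 1 \<or> e = -1"
  shows "sum (cprob e m) B \<le> 1"
proof -
  have "sum (cprob e m) B \<le> 1"
    if "finite B" "B \<subseteq> stopped m" "e = 1 \<or> e = -1" "\<And>es. es \<in> B \<Longrightarrow> length es \<le> n" for n B
    using that
  proof (induction n arbitrary: e m B)
    case 0
    then have "B \<subseteq> {[]}" by auto
    then have "B = {} \<or> B = {[]}" by blast
    then show ?case by auto
  next
    case (Suc n)
    consider "\<bar>m\<bar> < int N" | "\<bar>m\<bar> = int N" | "\<bar>m\<bar> > int N" by linarith
    then show ?case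
    proof cases
      case 1
      define C where "C d = {es. d # es \<in> B}" for d
      have fin: "finite (C d)" for d
        using finite_vimageI[OF Suc.prems(1), of "(#) d"] by (simp add: C_def vimage_def)
      have sub: "C d \<subseteq> stopped (m + d)" for d
        using Suc.prems(2) by (auto simp: C_def)
      have len: "length es \<le> n" if "es \<in> C d" for es d
        using Suc.prems(4)[of "d # es"] that by (auto simp: C_def)
      have "es \<in> (#) 1 ` C 1 \<union> (#) (-1) ` C (-1)" if "es \<in> B" for es
        using 1 subsetD[OF Suc.prems(2) that] that by (cases es) (auto simp: C_def)
      then have "B = (#) 1 ` C 1 \<union> (#) (-1) ` C (-1)"
        by (auto simp: C_def)
      then have "sum (cprob e m) B = sum (cprob e m) ((#) 1 ` C 1) + sum (cprob e m) ((#) (-1) ` C (-1))"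
        using fin by (subst sum.union_disjoint[symmetric]) auto
      also have "\<dots> = (\<Sum>es\<in>C 1. cprob e m (1 # es)) + (\<Sum>es\<in>C (-1). cprob e m ((-1) # es))"
        by (simp add: sum.reindex)
      also have "\<dots> = (if 1 = e then coef \<bar>m\<bar> else 1 - coef \<bar>m\<bar>) * sum (cprob 1 (m + 1)) (C 1)
          + (if -1 = e then coef \<bar>m\<bar> else 1 - coef \<bar>m\<bar>) * sum (cprob (-1) (m + -1)) (C (-1))"
        by (simp add: sum_distrib_left)
      also have "\<dots> \<le> (if 1 = e then coef \<bar>m\<bar> else 1 - coef \<bar>m\<bar>) * 1
          + (if -1 = e then coef \<bar>m\<bar> else 1 - coef \<bar>m\<bar>) * 1"
        using coef_bounds[of "\<bar>m\<bar>"]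
        by (intro add_mono mult_left_mono Suc.IH fin sub len) auto
      also have "\<dots> \<le> 1" using Suc.prems(3) by auto
      finally show ?thesis .
    next
      case 2
      then have "B = {} \<or> B = {[]}" using Suc.prems(2) stopped_exit[of m] by auto
      then show ?thesis by auto
    next
      case 3
      then have "B = {}" using Suc.prems(2) stopped_empty[of m] by auto
      then show ?thesis by simp
    qed
  qed
  from this[of B "Max (length ` B)"] show ?thesis
    using assms by simp
qed

abbreviation bdd1 :: "(int list \<Rightarrow> complex) \<Rightarrow> bool" where "bdd1 \<phi> \<equiv> \<forall>es. norm (\<phi> es) \<le> 1"

text \<open>Conditional expectation of a functional of the future, given that the last step was
  \<open>e\<close> and led to \<open>m\<close>.\<close>

definition esum :: "int \<Rightarrow> int \<Rightarrow> (int list \<Rightarrow> complex) \<Rightarrow> complex" where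
  "esum e m \<phi> = (\<Sum>\<^sub>\<infinity>es\<in>stopped m. complex_of_real (cprob e m es) * \<phi> es)"

lemma cprob_summable:
  assumes "e = 1 \<or> e = -1"
  shows "cprob e m summable_on stopped m"
  by (rule nonneg_bdd_above_summable_on)
     (use cprob_nonneg cprob_sum_le assms in \<open>auto intro!: bdd_aboveI2[where M = 1]\<close>)

lemma cprob_infsum_le:
  assumes "e = 1 \<or> e = -1"
  shows "infsum (cprob e m) (stopped m) \<le> 1"
  by (rule infsum_le_finite_sums[OF cprob_summable]) (use cprob_sum_le assms in auto)

lemma esum_abs_summable:
  assumes "bdd1 \<phi>" "e = 1 \<or> e = -1"
  shows "(\<lambda>es. norm (complex_of_real (cprob e m es) * \<phi> es)) summable_on stopped m"
proof (rule Infinite_Sum.abs_summable_on_comparison_test'[OF cprob_summable[OF assms(2)]])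
  show "norm (complex_of_real (cprob e m es) * \<phi> es) \<le> cprob e m es" for es
    using assms(1) cprob_nonneg[of e m es]
    by (simp add: norm_mult mult_left_le)
qed

lemma esum_summable:
  assumes "bdd1 \<phi>" "e = 1 \<or> e = -1"
  shows "(\<lambda>es. complex_of_real (cprob e m es) * \<phi> es) summable_on stopped m"
  using esum_abs_summable[OF assms] by (rule abs_summable_summable)

lemma norm_esum_le:
  assumes "bdd1 \<phi>" "e = 1 \<or> e = -1"
  shows "norm (esum e m \<phi>) \<le> 1"
proof -
  have "norm (esum e m \<phi>) \<le> infsum (cprob e m) (stopped m)"
    unfolding esum_def
  proof (rule norm_infsum_le[OF has_sum_infsum[OF esum_summable[OF assms]] has_sum_infsum[OF cprob_summable[OF assms(2)]]])
    show "norm (complex_of_real (cprob e m es) * \<phi> es) \<le> cprob e m es" for es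
      using assms(1) cprob_nonneg[of e m es]
      by (simp add: norm_mult mult_left_le)
  qed
  with cprob_infsum_le[OF assms(2), of m] show ?thesis by simp
qed

lemma infsum_first_step:
  fixes g :: "int list \<Rightarrow> complex"
  assumes "\<bar>m\<bar> < int N"
    and "(\<lambda>es. g (1 # es)) summable_on stopped (m + 1)"
    and "(\<lambda>es. g (-1 # es)) summable_on stopped (m - 1)"
  shows "infsum g (stopped m) =
    (\<Sum>\<^sub>\<infinity>es\<in>stopped (m + 1). g (1 # es)) + (\<Sum>\<^sub>\<infinity>es\<in>stopped (m - 1). g (-1 # es))"
proof -
  have s: "g summable_on (#) 1 ` stopped (m + 1)" "g summable_on (#) (-1) ` stopped (m - 1)"
    using assms(2,3) by (auto simp: summable_on_reindex comp_def)
  show ?thesis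
    unfolding stopped_rec[OF assms(1)]
    by (subst infsum_Un_disjoint[OF s]) (auto simp: infsum_reindex comp_def)
qed

lemma esum_step:
  assumes "\<bar>m\<bar> < int N" "bdd1 \<phi>"
  shows "esum e m \<phi> =
      of_real (if e = 1 then coef \<bar>m\<bar> else 1 - coef \<bar>m\<bar>) * esum 1 (m + 1) (\<lambda>es. \<phi> (1 # es))
    + of_real (if e = -1 then coef \<bar>m\<bar> else 1 - coef \<bar>m\<bar>) * esum (-1) (m - 1) (\<lambda>es. \<phi> (-1 # es))"
proof -
  have s1: "(\<lambda>es. complex_of_real (cprob 1 (m + 1) es) * \<phi> (1 # es)) summable_on stopped (m + 1)"
    using assms by (intro esum_summable) auto
  have s2: "(\<lambda>es. complex_of_real (cprob (-1) (m - 1) es) * \<phi> (-1 # es)) summable_on stopped (m - 1)"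
    using assms by (intro esum_summable) auto
  show ?thesis
    unfolding esum_def
    using summable_on_cmult_right[OF s1, of "of_real (coef \<bar>m\<bar>)"]
      summable_on_cmult_right[OF s1, of "of_real (1 - coef \<bar>m\<bar>)"]
      summable_on_cmult_right[OF s2, of "of_real (coef \<bar>m\<bar>)"]
      summable_on_cmult_right[OF s2, of "of_real (1 - coef \<bar>m\<bar>)"]
    by (subst infsum_first_step[OF assms(1)])
       (auto simp: infsum_cmult_right' mult.assoc)
qed

lemma esum_exit: "\<bar>m\<bar> = int N \<Longrightarrow> esum e m \<phi> = \<phi> []"
  by (simp add: esum_def stopped_exit)

lemma esum_uminus: "esum (- e) (- m) \<phi> = esum e m (\<lambda>es. \<phi> (map uminus es))"
  unfolding esum_def
  by (subst infsum_reindex_bij_betw[OF bij_betw_stopped_uminus[of N m], symmetric])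
     (simp add: gr_cprob_uminus)

lemma esum_cmult: "esum e m (\<lambda>es. c * \<phi> es) = c * esum e m \<phi>"
  by (simp add: esum_def infsum_cmult_right'[symmetric] mult_ac)

lemma esum_add:
  assumes "bdd1 \<phi>" "bdd1 \<psi>" "e = 1 \<or> e = -1"
  shows "esum e m (\<lambda>es. \<phi> es + \<psi> es) = esum e m \<phi> + esum e m \<psi>"
  unfolding esum_def distrib_left
  by (intro infsum_add esum_summable assms)

definition no_hit :: "int \<Rightarrow> int \<Rightarrow> complex" where
  "no_hit e m = esum e m (\<lambda>es. if gr_hits m es then 0 else 1)"

lemma no_hit_0: "no_hit e 0 = 0"
  by (simp add: no_hit_def esum_def)

lemma no_hit_exit: "0 < N \<Longrightarrow> no_hit e (int N) = 1"
  by (simp add: no_hit_def esum_exit)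

lemma no_hit_step:
  assumes "0 < m" "m < int N"
  shows "no_hit e m =
      of_real (if e = 1 then coef m else 1 - coef m) * no_hit 1 (m + 1)
    + of_real (if e = -1 then coef m else 1 - coef m) * no_hit (-1) (m - 1)"
  using assms unfolding no_hit_def by (subst esum_step) auto

lemma no_hit_uminus: "no_hit (- e) (- m) = no_hit e m"
  by (simp add: no_hit_def esum_uminus gr_hits_uminus)

end

section \<open>Complex weights and their first-step equations\<close>

locale ruin_weight = ruin +
  fixes s r bt g :: real
begin

text \<open>A step, the start of a run, the end of a short run and the end of an excursion are weighted by
  \<open>z\<close>, \<open>y\<close>, \<open>x\<close> and \<open>w\<close>.\<close>

definition z :: complex where "z = cis s"
definition y :: complex where "y = cis (- s * r)"
definition x :: complex where "x = cis (s * bt)"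
definition w :: complex where "w = cis (- s * g)"

definition xw :: "bool \<Rightarrow> complex" where "xw fr = (if fr then x else 1)"

abbreviation lin :: "int \<Rightarrow> int list \<Rightarrow> real" where "lin \<equiv> gr_lin r bt g"
abbreviation run_lin :: "bool \<Rightarrow> int \<Rightarrow> int \<Rightarrow> int list \<Rightarrow> real" where
  "run_lin \<equiv> gr_run_lin r bt g"

definition full :: "int \<Rightarrow> int \<Rightarrow> complex" where
  "full e m = esum e m (\<lambda>es. cis (s * lin m es))"

definition hit :: "int \<Rightarrow> int \<Rightarrow> complex" where
  "hit e m = esum e m (\<lambda>es. if gr_hits m es then cis (s * lin m es) else 0)"

text \<open>The unknown of the recursion inside an excursion. The argument \<open>e\<close> serves
  both as last increment of the walk and as last increment of its absolute value; the two agree on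
  the positive side, where the recursion is used.\<close>

definition run :: "bool \<Rightarrow> int \<Rightarrow> int \<Rightarrow> complex" where
  "run fr e m = esum e m (\<lambda>es. if gr_hits m es then cis (s * run_lin fr e m es) else 0)"

lemma hit_0: "hit e 0 = full e 0"
  by (simp add: hit_def full_def)

lemma norm_hit_le: "e = 1 \<or> e = -1 \<Longrightarrow> norm (hit e m) \<le> 1"
  unfolding hit_def by (rule norm_esum_le) auto

lemma esum_hit_Cons:
  assumes "m \<noteq> 0"
  shows "esum e' (m + e) (\<lambda>es. if gr_hits m (e # es) then cis (s * lin m (e # es)) else 0)
    = z * hit e' (m + e)"
proof -
  have "(\<lambda>es. if gr_hits m (e # es) then cis (s * lin m (e # es)) else 0)
      = (\<lambda>es. z * (if gr_hits (m + e) es then cis (s * lin (m + e) es) else 0))"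
    using assms by (auto simp: gr_lin_Cons z_def cis_mult algebra_simps fun_eq_iff)
  then show ?thesis by (simp add: esum_cmult hit_def)
qed

lemma hit_step:
  assumes "0 < m" "m < int N"
  shows "hit e m =
      of_real (if e = 1 then coef m else 1 - coef m) * z * hit 1 (m + 1)
    + of_real (if e = -1 then coef m else 1 - coef m) * z * hit (-1) (m - 1)"
  using assms esum_hit_Cons[of m 1 1] esum_hit_Cons[of m "-1" "-1"]
  unfolding hit_def[of e m] by (subst esum_step) (auto simp: mult.assoc)

lemma esum_run_Cons:
  assumes "m > 0" "e = 1 \<or> e = -1" "d = 1 \<or> d = -1"
  shows "esum e (m + e) (\<lambda>es. if gr_hits m (e # es) then cis (s * run_lin fr d m (e # es)) else 0)
    = (if d = e then z else z * y * xw fr) * run (d \<noteq> e) e (m + e)"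
proof -
  have "(\<lambda>es. if gr_hits m (e # es) then cis (s * run_lin fr d m (e # es)) else 0)
      = (\<lambda>es. (if d = e then z else z * y * xw fr) *
          (if gr_hits (m + e) es then cis (s * run_lin (d \<noteq> e) e (m + e) es) else 0))"
    using assms
    by (auto simp: gr_run_lin_Cons z_def y_def x_def xw_def cis_mult algebra_simps fun_eq_iff)
  then show ?thesis by (simp add: esum_cmult run_def)
qed

lemma run_step_up:
  assumes "0 < m" "m < int N"
  shows "run fr 1 m = of_real (coef m) * z * run False 1 (m + 1)
    + of_real (1 - coef m) * z * y * xw fr * run True (-1) (m - 1)"
  using assms esum_run_Cons[of m 1 1 fr] esum_run_Cons[of m "-1" 1 fr]
  unfolding run_def[of fr 1 m] by (subst esum_step) (auto simp: mult.assoc)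

lemma run_step_down:
  assumes "0 < m" "m < int N"
  shows "run fr (-1) m = of_real (coef m) * z * run False (-1) (m - 1)
    + of_real (1 - coef m) * z * y * xw fr * run True 1 (m + 1)"
  using assms esum_run_Cons[of m "-1" "-1" fr] esum_run_Cons[of m 1 "-1" fr]
  unfolding run_def[of fr "-1" m] by (subst esum_step) (auto simp: mult.assoc)

lemma run_exit: "0 < N \<Longrightarrow> run fr e (int N) = 0"
  by (simp add: run_def esum_exit)

lemma run_0: "run fr e 0 = w * xw fr * full e 0"
proof -
  have "(\<lambda>es. cis (s * run_lin fr e 0 es)) = (\<lambda>es. w * xw fr * cis (s * lin 0 es))"
    by (auto simp: gr_run_lin_zero w_def x_def xw_def cis_mult algebra_simps fun_eq_iff)
  then show ?thesis by (simp add: run_def full_def esum_cmult)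
qed

text \<open>Paths that return to 0 pay for one step and one newly opened run; paths that do not
  return have weight 1. Reflection moves the negative side to the positive one.\<close>

lemma esum_zero_Cons:
  assumes "e = 1 \<or> e = -1"
  shows "esum e e (\<lambda>es. cis (s * lin 0 (e # es))) = no_hit 1 1 + z * y * run True 1 1"
proof -
  have "(\<lambda>es. cis (s * lin 0 (e # es))) = (\<lambda>es. (if gr_hits e es then 0 else 1)
      + z * y * (if gr_hits e es then cis (s * run_lin True 1 e es) else 0))"
    using assms by (auto simp: gr_lin_zero_Cons z_def y_def cis_mult algebra_simps fun_eq_iff)
  then have "esum e e (\<lambda>es. cis (s * lin 0 (e # es)))
      = esum e e (\<lambda>es. (if gr_hits e es then 0 else 1)
          + z * y * (if gr_hits e es then cis (s * run_lin True 1 e es) else 0))"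
    by simp
  also have "\<dots> = no_hit e e
        + z * y * esum e e (\<lambda>es. if gr_hits e es then cis (s * run_lin True 1 e es) else 0)"
    unfolding no_hit_def esum_cmult[symmetric]
    using assms by (subst esum_add) (auto simp: z_def y_def norm_mult)
  also have "no_hit e e = no_hit 1 1"
    using assms no_hit_uminus[of 1 1] by auto
  also have "esum e e (\<lambda>es. if gr_hits e es then cis (s * run_lin True 1 e es) else 0) = run True 1 1"
    using assms esum_uminus[of 1 1 "\<lambda>es. if gr_hits (-1) es then cis (s * run_lin True 1 (-1) es) else 0"]
      gr_hits_uminus[of 1] gr_run_lin_uminus[of r bt g True 1 1]
    by (auto simp: run_def cong: if_cong)
  finally show ?thesis .
qed

text \<open>The probabilities of repeating and of reversing the previous step add up to one, and
  both continuations have the same value by symmetry; hence the value at 0 is the same for both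
  directions \<open>e\<close>.\<close>

lemma full_0:
  assumes "0 < N" "e = 1 \<or> e = -1"
  shows "full e 0 = no_hit 1 1 + z * y * run True 1 1"
  unfolding full_def
  using assms esum_zero_Cons[of 1] esum_zero_Cons[of "-1"]
  by (subst esum_step) (auto simp: algebra_simps)

end

context ruin
begin

text \<open>The very first increment is a fair coin, hence the plain average; persistence enters
  from the second step on.\<close>

lemma gr_charfun_first_step:
  fixes t :: real and m :: int
  defines "s \<equiv> t / real N"
    and "r \<equiv> (2 - a - b) / ((1 - a) * (1 - b))" and "bt \<equiv> 1 / ((1 - a) * (1 - b))"
    and "g \<equiv> a * (b - a) / ((1 - a) * (1 - b))"
  assumes m: "\<bar>m\<bar> < int N"
  shows "gr_charfun a b f N m t =
    (esum 1 (m + 1) (\<lambda>es. cis (s * gr_lin r bt g m (1 # es)))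
      + esum (-1) (m - 1) (\<lambda>es. cis (s * gr_lin r bt g m (-1 # es)))) / 2"
proof -
  let ?\<phi> = "\<lambda>es. cis (s * gr_lin r bt g m es)"
  have e: "exp (\<i> * complex_of_real (t * gr_stat a b N m es)) = ?\<phi> es" for es
    by (simp add: gr_stat_eq s_def r_def bt_def g_def cis_conv_exp mult_ac)
  have h: "complex_of_real (gr_prob a b f m (e # es)) * \<psi>
      = 1/2 * (complex_of_real (cprob e (m + e) es) * \<psi>)" for e es \<psi>
    by (simp add: gr_prob_Cons)
  have h': "complex_of_real (gr_prob a b f m (-1 # es)) * \<psi>
      = 1/2 * (complex_of_real (cprob (-1) (m - 1) es) * \<psi>)" for es \<psi>
    using h[of "-1"] by simp
  show ?thesis
    unfolding gr_charfun_def e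
    by (subst infsum_first_step[OF m])
       (auto simp only: h[of 1] h' infsum_cmult_right' esum_def[symmetric] add_divide_distrib
         intro!: summable_on_cmult_right esum_summable, auto)
qed

end

section \<open>Powers of two-by-two matrices close to the identity\<close>

definition lin2 :: "complex \<Rightarrow> complex \<Rightarrow> complex \<Rightarrow> complex \<Rightarrow> complex \<times> complex \<Rightarrow> complex \<times> complex" where
  "lin2 m11 m12 m21 m22 v = (m11 * fst v + m12 * snd v, m21 * fst v + m22 * snd v)"

definition n1 :: "complex \<times> complex \<Rightarrow> real" where
  "n1 v = norm (fst v) + norm (snd v)"

lemma n1_nonneg [simp]: "0 \<le> n1 v"
  by (simp add: n1_def)

lemma n1_triangle: "n1 (u + v) \<le> n1 u + n1 v"
  using norm_triangle_ineq[of "fst u" "fst v"] norm_triangle_ineq[of "snd u" "snd v"]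
  by (simp add: n1_def)

text \<open>The operator norm belonging to \<open>n1\<close> is the largest column sum, which is why
  matrices are controlled by columns below.\<close>

lemma n1_lin2_le:
  assumes "norm m11 + norm m21 \<le> c" "norm m12 + norm m22 \<le> c"
  shows "n1 (lin2 m11 m12 m21 m22 v) \<le> c * n1 v"
proof -
  have "n1 (lin2 m11 m12 m21 m22 v)
      \<le> (norm m11 * norm (fst v) + norm m12 * norm (snd v))
        + (norm m21 * norm (fst v) + norm m22 * norm (snd v))"
    unfolding n1_def lin2_def fst_conv snd_conv
    by (intro add_mono norm_triangle_mono) (auto simp: norm_mult)
  also have "\<dots> = (norm m11 + norm m21) * norm (fst v) + (norm m12 + norm m22) * norm (snd v)"
    by (simp add: algebra_simps)
  also have "\<dots> \<le> c * norm (fst v) + c * norm (snd v)"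
    using assms by (intro add_mono mult_right_mono) auto
  finally show ?thesis by (simp add: n1_def algebra_simps)
qed

text \<open>A discrete Gronwall estimate: each step multiplies the old error by at most
  \<open>c\<close> and adds the matrix distance \<open>d\<close> applied to the comparison orbit,
  itself bounded by powers of \<open>c\<close>.\<close>

lemma n1_funpow_diff_le:
  fixes m11 m12 m21 m22 e11 e12 e21 e22 :: complex
  defines "M \<equiv> lin2 m11 m12 m21 m22" and "E \<equiv> lin2 e11 e12 e21 e22"
  assumes c: "1 \<le> c"
    and M: "norm m11 + norm m21 \<le> c" "norm m12 + norm m22 \<le> c"
    and E: "norm e11 + norm e21 \<le> c" "norm e12 + norm e22 \<le> c"
    and d: "norm (m11 - e11) + norm (m21 - e21) \<le> d" "norm (m12 - e12) + norm (m22 - e22) \<le> d"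
  shows "n1 ((M ^^ n) v - (E ^^ n) w) \<le> c ^ n * (n1 (v - w) + real n * d * n1 w)"
proof (induction n)
  case (Suc n)
  let ?v = "(M ^^ n) v" and ?w = "(E ^^ n) w"
  have d0: "0 \<le> d" using d(1) norm_ge_zero[of "m11 - e11"] norm_ge_zero[of "m21 - e21"] by linarith
  have w: "n1 ((E ^^ k) w) \<le> c ^ k * n1 w" for k
  proof (induction k)
    case (Suc k)
    have "n1 ((E ^^ Suc k) w) \<le> c * n1 ((E ^^ k) w)"
      unfolding E_def by simp (intro n1_lin2_le E)
    also have "\<dots> \<le> c * (c ^ k * n1 w)" using Suc c by (intro mult_left_mono) auto
    finally show ?case by simp
  qed simp
  have eq: "(M ^^ Suc n) v - (E ^^ Suc n) w
      = M (?v - ?w) + lin2 (m11 - e11) (m12 - e12) (m21 - e21) (m22 - e22) ?w"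
    by (simp add: M_def E_def lin2_def prod_eq_iff algebra_simps)
  have "n1 ((M ^^ Suc n) v - (E ^^ Suc n) w) \<le> c * n1 (?v - ?w) + d * n1 ?w"
    unfolding eq
    by (intro order_trans[OF n1_triangle] add_mono n1_lin2_le d) (unfold M_def, intro n1_lin2_le M)
  also have "\<dots> \<le> c * (c ^ n * (n1 (v - w) + real n * d * n1 w)) + d * (c ^ n * n1 w)"
    using Suc w c d0 by (intro add_mono mult_left_mono) auto
  also have "\<dots> \<le> c * (c ^ n * (n1 (v - w) + real n * d * n1 w)) + d * (c * (c ^ n * n1 w))"
    using c d0 mult_right_mono[OF c, of "c ^ n * n1 w"] by (intro add_left_mono mult_left_mono) auto
  also have "\<dots> = c ^ Suc n * (n1 (v - w) + real (Suc n) * d * n1 w)"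
    by (simp add: algebra_simps)
  finally show ?case .
qed simp

section \<open>The limiting hyperbolic flow\<close>

definition shc :: "real \<Rightarrow> real \<Rightarrow> real" where
  "shc \<mu> u = (if \<mu> = 0 then u else sinh (\<mu> * u) / \<mu>)"

text \<open>When \<alpha> \<kappa> = -\<mu>^2, this is exp(u L) for the matrix L with rows (0,
  -\<alpha>) and (\<kappa>, 0). Since \<mu> = 0 occurs at t = 0, the quotient sinh(\<mu> u) / \<mu>
  is replaced by its continuous extension \<open>shc\<close>.\<close>

definition flow :: "real \<Rightarrow> real \<Rightarrow> real \<Rightarrow> real \<Rightarrow> complex \<times> complex \<Rightarrow> complex \<times> complex" where
  "flow \<mu> \<alpha> \<kappa> u = lin2 (of_real (cosh (\<mu> * u))) (of_real (- \<alpha> * shc \<mu> u))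
      (of_real (\<kappa> * shc \<mu> u)) (of_real (cosh (\<mu> * u)))"

lemma shc_add: "shc \<mu> (u + v) = shc \<mu> u * cosh (\<mu> * v) + cosh (\<mu> * u) * shc \<mu> v"
  by (simp add: shc_def distrib_left sinh_add add_divide_distrib)

lemma flow_0 [simp]: "flow \<mu> \<alpha> \<kappa> 0 = id"
  by (simp add: flow_def lin2_def shc_def fun_eq_iff)

lemma flow_add:
  assumes "\<alpha> * \<kappa> = - \<mu>\<^sup>2"
  shows "flow \<mu> \<alpha> \<kappa> u (flow \<mu> \<alpha> \<kappa> v w) = flow \<mu> \<alpha> \<kappa> (u + v) w"
proof -
  have "\<mu>\<^sup>2 * (shc \<mu> u * shc \<mu> v) = sinh (\<mu> * u) * sinh (\<mu> * v)"
    by (simp add: shc_def power2_eq_square)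
  then have c: "cosh (\<mu> * (u + v)) = cosh (\<mu> * u) * cosh (\<mu> * v) - \<alpha> * \<kappa> * (shc \<mu> u * shc \<mu> v)"
    by (simp add: assms distrib_left cosh_add)
  show ?thesis
    unfolding flow_def lin2_def c shc_add
    by (simp add: algebra_simps)
qed

text \<open>Powers of the flow over a step 1/N are again flows, without error, which makes it the
  comparison matrix for the products in a stratum.\<close>

lemma funpow_flow:
  assumes "\<alpha> * \<kappa> = - \<mu>\<^sup>2"
  shows "(flow \<mu> \<alpha> \<kappa> u ^^ n) w = flow \<mu> \<alpha> \<kappa> (real n * u) w"
  by (induction n) (simp_all add: flow_add[OF assms] algebra_simps)

lemma isCont_shc: "isCont (shc \<mu>) u"
  by (cases "\<mu> = 0") (auto simp: shc_def[abs_def] intro!: continuous_intros)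

lemma tendsto_lin2:
  assumes "(m11 \<longlongrightarrow> l11) F" "(m12 \<longlongrightarrow> l12) F" "(m21 \<longlongrightarrow> l21) F" "(m22 \<longlongrightarrow> l22) F"
    and "(v \<longlongrightarrow> l) F"
  shows "((\<lambda>N. lin2 (m11 N) (m12 N) (m21 N) (m22 N) (v N)) \<longlongrightarrow> lin2 l11 l12 l21 l22 l) F"
  unfolding lin2_def by (intro tendsto_intros assms)

lemma tendsto_flow:
  assumes "(h \<longlongrightarrow> L) F"
  shows "((\<lambda>N. flow \<mu> \<alpha> \<kappa> (h N) w) \<longlongrightarrow> flow \<mu> \<alpha> \<kappa> L w) F"
  unfolding flow_def
  by (intro tendsto_lin2 tendsto_of_real tendsto_intros isCont_tendsto_compose[OF isCont_shc] assms)

lemma scaled_difference_tendsto: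
  fixes g :: "real \<Rightarrow> real"
  assumes "(g has_field_derivative D) (at 0)"
  shows "(\<lambda>N. real N * (g (1 / real N) - g 0)) \<longlonglongrightarrow> D"
proof -
  have "filterlim (\<lambda>N. 1 / real N) (at 0) sequentially"
    by (intro filterlim_atI lim_1_over_n) (auto intro!: eventually_sequentiallyI[of 1])
  with assms have "(\<lambda>N. (g (1 / real N) - g 0) / (1 / real N)) \<longlonglongrightarrow> D"
    unfolding DERIV_def by (auto dest: filterlim_compose)
  then show ?thesis by (simp add: mult.commute)
qed

lemma cosh_scaled_tendsto: "(\<lambda>N. real N * (cosh (\<mu> * (1 / real N)) - 1)) \<longlonglongrightarrow> 0"
proof -
  have "((\<lambda>u. cosh (\<mu> * u)) has_field_derivative 0) (at 0)"
    by (auto intro!: derivative_eq_intros)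
  from scaled_difference_tendsto[OF this] show ?thesis by simp
qed

lemma shc_scaled_tendsto: "(\<lambda>N. real N * shc \<mu> (1 / real N)) \<longlonglongrightarrow> 1"
proof -
  have "(shc \<mu> has_field_derivative 1) (at 0)"
    by (cases "\<mu> = 0") (auto simp: shc_def[abs_def] intro!: derivative_eq_intros)
  moreover have "shc \<mu> 0 = 0" by (simp add: shc_def)
  ultimately show ?thesis using scaled_difference_tendsto by fastforce
qed

lemma norm_colsum_le:
  fixes m e :: complex
  assumes "norm (of_nat N * (m - 1)) \<le> K" "norm (of_nat N * e) \<le> K" "0 < N"
  shows "norm m + norm e \<le> 1 + 2 * K / real N"
proof -
  have "norm m \<le> 1 + norm (m - 1)"
    using norm_triangle_ineq[of 1 "m - 1"] by simp
  moreover have "norm (m - 1) \<le> K / real N" "norm e \<le> K / real N"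
    using assms by (simp_all add: norm_mult pos_le_divide_eq mult.commute del: right_diff_distrib)
  ultimately show ?thesis by simp
qed

text \<open>The given matrix and the flow over time 1/N share the same generator, so they differ by
  o(1/N). Over n N = O(N) steps these errors add up to o(1), while the accumulated norms stay below
  exp(2 K n/N).\<close>

lemma funpow_lin2_tendsto:
  fixes m11 m12 m21 m22 :: "nat \<Rightarrow> complex" and n :: "nat \<Rightarrow> nat" and \<mu> \<alpha> \<kappa> :: real
  assumes \<mu>: "\<alpha> * \<kappa> = - \<mu>\<^sup>2"
    and m11: "(\<lambda>N. of_nat N * (m11 N - 1)) \<longlonglongrightarrow> 0"
    and m12: "(\<lambda>N. of_nat N * m12 N) \<longlonglongrightarrow> - of_real \<alpha>"
    and m21: "(\<lambda>N. of_nat N * m21 N) \<longlonglongrightarrow> of_real \<kappa>"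
    and m22: "(\<lambda>N. of_nat N * (m22 N - 1)) \<longlonglongrightarrow> 0"
    and n: "(\<lambda>N. real (n N) / real N) \<longlonglongrightarrow> L"
    and v: "v \<longlonglongrightarrow> l"
  shows "(\<lambda>N. (lin2 (m11 N) (m12 N) (m21 N) (m22 N) ^^ n N) (v N)) \<longlonglongrightarrow> flow \<mu> \<alpha> \<kappa> L l"
proof -
  define e11 where "e11 N = complex_of_real (cosh (\<mu> * (1 / real N)))" for N :: nat
  define e12 where "e12 N = complex_of_real (- \<alpha> * shc \<mu> (1 / real N))" for N :: nat
  define e21 where "e21 N = complex_of_real (\<kappa> * shc \<mu> (1 / real N))" for N :: nat
  have e11: "(\<lambda>N. of_nat N * (e11 N - 1)) \<longlonglongrightarrow> 0"
    using tendsto_of_real[OF cosh_scaled_tendsto[of \<mu>], where 'a = complex] by (simp add: e11_def)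
  have e12: "(\<lambda>N. of_nat N * e12 N) \<longlonglongrightarrow> - of_real \<alpha>"
    using tendsto_of_real[OF tendsto_mult_left[OF shc_scaled_tendsto[of \<mu>], of "- \<alpha>"], where 'a = complex]
    by (simp add: e12_def mult_ac)
  have e21: "(\<lambda>N. of_nat N * e21 N) \<longlonglongrightarrow> of_real \<kappa>"
    using tendsto_of_real[OF tendsto_mult_left[OF shc_scaled_tendsto[of \<mu>], of "\<kappa>"], where 'a = complex]
    by (simp add: e21_def mult_ac)
  have ex: "\<exists>K. \<forall>N. norm (g N) \<le> K" if "g \<longlonglongrightarrow> (c :: complex)" for g c
    using that by (meson Bseq_def convergentI convergent_imp_Bseq)
  obtain K1 where K1: "\<And>N. norm (of_nat N * (m11 N - 1)) \<le> K1"
    using ex[OF m11] by blast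
  obtain K2 where K2: "\<And>N. norm (of_nat N * m12 N) \<le> K2"
    using ex[OF m12] by blast
  obtain K3 where K3: "\<And>N. norm (of_nat N * m21 N) \<le> K3"
    using ex[OF m21] by blast
  obtain K4 where K4: "\<And>N. norm (of_nat N * (m22 N - 1)) \<le> K4"
    using ex[OF m22] by blast
  obtain K5 where K5: "\<And>N. norm (of_nat N * (e11 N - 1)) \<le> K5"
    using ex[OF e11] by blast
  obtain K6 where K6: "\<And>N. norm (of_nat N * e12 N) \<le> K6"
    using ex[OF e12] by blast
  obtain K7 where K7: "\<And>N. norm (of_nat N * e21 N) \<le> K7"
    using ex[OF e21] by blast
  \<comment> \<open>One bound for all scaled entries. A column contains two of them, so its sum is
    at most 1 + 2 K / N for both matrices.\<close>
  define K where "K = K1 + K2 + K3 + K4 + K5 + K6 + K7"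
  have "0 \<le> K1" "0 \<le> K2" "0 \<le> K3" "0 \<le> K4" "0 \<le> K5" "0 \<le> K6" "0 \<le> K7"
    using K1 K2 K3 K4 K5 K6 K7 by (meson norm_ge_zero order_trans)+
  then have KK: "K1 \<le> K" "K2 \<le> K" "K3 \<le> K" "K4 \<le> K" "K5 \<le> K" "K6 \<le> K" "K7 \<le> K"
    and K0: "0 \<le> K"
    unfolding K_def by linarith+
  note K' = K1[THEN order_trans, OF KK(1)] K2[THEN order_trans, OF KK(2)]
    K3[THEN order_trans, OF KK(3)] K4[THEN order_trans, OF KK(4)]
    K5[THEN order_trans, OF KK(5)] K6[THEN order_trans, OF KK(6)]
    K7[THEN order_trans, OF KK(7)]
  \<comment> \<open>N times the entrywise distance of the two matrices, summed over all entries so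
    that it dominates both columns.\<close>
  define d where "d N = norm (of_nat N * (m11 N - 1) - of_nat N * (e11 N - 1))
      + norm (of_nat N * m21 N - of_nat N * e21 N)
      + (norm (of_nat N * m12 N - of_nat N * e12 N)
      + norm (of_nat N * (m22 N - 1) - of_nat N * (e11 N - 1)))" for N
  have "d \<longlonglongrightarrow> norm (0 - 0 :: complex) + norm (of_real \<kappa> - of_real \<kappa> :: complex)
      + (norm (- of_real \<alpha> - - of_real \<alpha> :: complex) + norm (0 - 0 :: complex))"
    unfolding d_def[abs_def] by (intro tendsto_add tendsto_norm tendsto_diff m11 m12 m21 m22 e11 e12 e21)
  then have d: "d \<longlonglongrightarrow> 0" by simp
  let ?M = "\<lambda>N. lin2 (m11 N) (m12 N) (m21 N) (m22 N) ^^ n N"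
  let ?w = "\<lambda>N. flow \<mu> \<alpha> \<kappa> (real (n N) / real N) l"
  let ?B = "\<lambda>N. exp (2 * K * (real (n N) / real N)) * (n1 (v N - l) + real (n N) / real N * d N * n1 l)"
  have bound: "n1 (?M N (v N) - ?w N) \<le> ?B N" if N: "0 < N" for N
  proof -
    have w: "?w N = (lin2 (e11 N) (e12 N) (e21 N) (e11 N) ^^ n N) l"
      using funpow_flow[OF \<mu>, of "n N" "1 / real N" l] by (simp add: flow_def e11_def e12_def e21_def)
    have "n1 (?M N (v N) - ?w N)
        \<le> (1 + 2 * K / real N) ^ n N * (n1 (v N - l) + real (n N) * (d N / real N) * n1 l)"
      unfolding w
    proof (rule n1_funpow_diff_le)
      show "norm (m11 N) + norm (m21 N) \<le> 1 + 2 * K / real N"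
        by (intro norm_colsum_le K' N)
      show "norm (m12 N) + norm (m22 N) \<le> 1 + 2 * K / real N"
        by (subst add.commute) (intro norm_colsum_le K' N)
      show "norm (e11 N) + norm (e21 N) \<le> 1 + 2 * K / real N"
        by (intro norm_colsum_le K' N)
      show "norm (e12 N) + norm (e11 N) \<le> 1 + 2 * K / real N"
        by (subst add.commute) (intro norm_colsum_le K' N)
      have r: "norm (u - u') = norm (of_nat N * u - of_nat N * u') / real N" for u u' :: complex
        using N by (simp add: right_diff_distrib[symmetric] norm_mult)
      have r': "of_nat N * (u - 1) - of_nat N * (u' - 1) = of_nat N * u - of_nat N * u'" for u u' :: complex
        by (simp add: algebra_simps)
      show "norm (m11 N - e11 N) + norm (m21 N - e21 N) \<le> d N / real N"
        unfolding d_def r[of "m11 N"] r[of "m21 N"] r' add_divide_distrib by simp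
      show "norm (m12 N - e12 N) + norm (m22 N - e11 N) \<le> d N / real N"
        unfolding d_def r[of "m12 N"] r[of "m22 N"] r' add_divide_distrib by simp
    qed (use K0 in auto)
    also have "(1 + 2 * K / real N) ^ n N \<le> exp (2 * K / real N) ^ n N"
      using K0 by (intro power_mono exp_ge_add_one_self) auto
    also have "\<dots> = exp (2 * K * (real (n N) / real N))"
      by (simp add: exp_of_nat_mult[symmetric] mult_ac)
    finally show ?thesis
      using K0 by (simp add: mult_right_mono d_def)
  qed
  have "?B \<longlonglongrightarrow> exp (2 * K * L) * (n1 (l - l) + L * 0 * n1 l)"
    unfolding n1_def by (intro tendsto_intros n v d)
  then have B: "?B \<longlonglongrightarrow> 0" by (simp add: n1_def)
  have "(\<lambda>N. ?M N (v N) - ?w N) \<longlonglongrightarrow> 0"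
  proof (rule Lim_null_comparison[OF _ B])
    have "norm u \<le> n1 u" for u :: "complex \<times> complex"
      using norm_Pair_le[of "fst u" "snd u"] by (simp add: n1_def)
    then show "\<forall>\<^sub>F N in sequentially. norm (?M N (v N) - ?w N) \<le> ?B N"
      using bound by (intro eventually_sequentiallyI[of 1]) (meson order_trans less_le_trans zero_less_one)
  qed
  from tendsto_add[OF this tendsto_flow[OF n, of \<mu> \<alpha> \<kappa> l]] show ?thesis by simp
qed

section \<open>The one-step matrices and their limits\<close>

text \<open>Entries of the transfer matrix in the coordinates (p, p - q), obtained by solving the
  two equations assumed in \<open>step_map_eq\<close>. Here \<open>A\<close> is the weight of
  continuing, \<open>C\<close> that of reversing after a single step, and \<open>cp\<close>,
  \<open>cm\<close> are the corrections for older runs at the levels above and below.\<close>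

definition sm11 :: "complex \<Rightarrow> complex \<Rightarrow> complex \<Rightarrow> complex \<Rightarrow> complex" where
  "sm11 A C cp cm = (A + A * cp + C * (1 - C) / A) / (1 + C * cm)"
definition sm12 :: "complex \<Rightarrow> complex \<Rightarrow> complex \<Rightarrow> complex \<Rightarrow> complex" where
  "sm12 A C cp cm = - (A * cp + C / A) / (1 + C * cm)"
definition sm21 :: "complex \<Rightarrow> complex \<Rightarrow> complex \<Rightarrow> complex \<Rightarrow> complex" where
  "sm21 A C cp cm = (A\<^sup>2 * (1 + cp) * (1 + cm) - (1 - C)\<^sup>2) / (A * (1 + C * cm))"
definition sm22 :: "complex \<Rightarrow> complex \<Rightarrow> complex \<Rightarrow> complex \<Rightarrow> complex" where
  "sm22 A C cp cm = (1 - C - A\<^sup>2 * cp * (1 + cm)) / (A * (1 + C * cm))"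

definition step_map ::
    "nat \<Rightarrow> complex \<Rightarrow> complex \<Rightarrow> complex \<Rightarrow> complex \<Rightarrow> complex \<times> complex \<Rightarrow> complex \<times> complex" where
  "step_map N A C cp cm = lin2 (sm11 A C cp cm) (sm12 A C cp cm / of_nat N)
     (of_nat N * sm21 A C cp cm) (sm22 A C cp cm)"

text \<open>The second equation gives \<open>q'\<close> in terms of \<open>p'\<close>; inserting it
  into the first leaves \<open>p'\<close> with the factor 1 + C cm, the common denominator of all
  entries. Scaling the difference by N multiplies or divides the off-diagonal entries by N.\<close>

lemma step_map_eq:
  assumes p': "p' = A * (p + cp * q) + C * q'" and q: "q = A * (q' + cm * p') + C * p"
    and nz: "A \<noteq> 0" "1 + C * cm \<noteq> 0" "0 < N"
  shows "(p', of_nat N * (p' - q')) = step_map N A C cp cm (p, of_nat N * (p - q))"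
proof -
  have q': "q' = (q - C * p) / A - cm * p'"
    using q nz by (simp add: field_simps)
  have "p' * (1 + C * cm) = A * (p + cp * q) + C * ((q - C * p) / A)"
    using p' unfolding q' by (simp add: algebra_simps)
  then have P: "p' = (A * (p + cp * q) + C * ((q - C * p) / A)) / (1 + C * cm)"
    using nz by (simp add: eq_divide_eq)
  have e1: "p' = sm11 A C cp cm * p + sm12 A C cp cm * (p - q)"
  proof -
    have "sm11 A C cp cm = (A\<^sup>2 + A\<^sup>2 * cp + C * (1 - C)) / (A * (1 + C * cm))"
      "sm12 A C cp cm = - (A\<^sup>2 * cp + C) / (A * (1 + C * cm))"
      using nz by (simp_all add: sm11_def sm12_def divide_simps) (simp_all add: algebra_simps power2_eq_square)
    moreover have "p' = (A\<^sup>2 * (p + cp * q) + C * (q - C * p)) / (A * (1 + C * cm))"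
      unfolding P using nz by (simp add: divide_simps) (simp add: algebra_simps power2_eq_square)
    ultimately show ?thesis
      by (simp only: times_divide_eq_left add_divide_distrib[symmetric])
        (rule arg_cong[where f = "\<lambda>u. u / _"], simp add: algebra_simps)
  qed
  have "p' - q' = (1 + cm) * p' - (q - C * p) / A"
    by (simp add: q' algebra_simps)
  also have "\<dots> = ((1 + cm) * (A * (p + cp * q) + C * ((q - C * p) / A))
      - (1 + C * cm) * ((q - C * p) / A)) / (1 + C * cm)"
    unfolding P using nz by (simp add: diff_divide_distrib)
  also have "\<dots> = (A * ((1 + cm) * (A * (p + cp * q) + C * ((q - C * p) / A))
      - (1 + C * cm) * ((q - C * p) / A))) / (A * (1 + C * cm))"
    using nz by simp
  also have "A * ((1 + cm) * (A * (p + cp * q) + C * ((q - C * p) / A))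
      - (1 + C * cm) * ((q - C * p) / A))
     = (1 + cm) * (A\<^sup>2 * (p + cp * q) + C * (q - C * p)) - (1 + C * cm) * (q - C * p)"
    using nz by (simp add: field_simps power2_eq_square)
  also have "\<dots> = (A\<^sup>2 * (1 + cp) * (1 + cm) - (1 - C)\<^sup>2) * p
      + (1 - C - A\<^sup>2 * cp * (1 + cm)) * (p - q)"
    by (simp add: algebra_simps power2_eq_square)
  finally have e2: "p' - q' = sm21 A C cp cm * p + sm22 A C cp cm * (p - q)"
    by (simp add: sm21_def sm22_def add_divide_distrib)
  show ?thesis
    unfolding step_map_def lin2_def e2 using nz e1 by (simp add: algebra_simps)
qed

text \<open>Second order is required because the lower left entry in a stratum carries two factors
  N: one from the scaled coordinate, one from the generator.\<close>

lemma cis_scaled2_tendsto: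
  "(\<lambda>N. of_nat N ^ 2 * (cis (u / real N) - 1 - \<i> * of_real (u / real N))) \<longlonglongrightarrow> - of_real (u\<^sup>2 / 2)"
proof -
  let ?z = "\<lambda>N. \<i> * complex_of_real (u / real N)"
  let ?R = "\<lambda>N. exp (?z N) - (\<Sum>i\<le>2. ?z N ^ i / fact i)"
  have "(\<lambda>N. of_nat N ^ 2 * ?R N) \<longlonglongrightarrow> 0"
  proof (rule Lim_null_comparison)
    show "(\<lambda>N. exp \<bar>u\<bar> * \<bar>u\<bar> ^ 3 / 2 * (1 / real N)) \<longlonglongrightarrow> 0"
      using tendsto_mult_left[OF lim_1_over_n, of "exp \<bar>u\<bar> * \<bar>u\<bar> ^ 3 / 2"] by simp
    show "\<forall>\<^sub>F N in sequentially. norm (of_nat N ^ 2 * ?R N) \<le> exp \<bar>u\<bar> * \<bar>u\<bar> ^ 3 / 2 * (1 / real N)"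
    proof (rule eventually_sequentiallyI[of 1])
      fix N :: nat assume N: "1 \<le> N"
      have nz: "norm (?z N) = \<bar>u\<bar> / real N" by (simp add: norm_mult norm_divide)
      have "norm (?R N) \<le> exp \<bar>Re (?z N)\<bar> * norm (?z N) ^ Suc 2 / fact 2"
        by (rule Taylor_exp)
      also have "\<dots> = (\<bar>u\<bar> / real N) ^ 3 / 2"
        unfolding nz by (simp add: numeral_3_eq_3)
      finally have "norm (of_nat N ^ 2 * ?R N) \<le> real N ^ 2 * ((\<bar>u\<bar> / real N) ^ 3 / 2)"
        unfolding norm_mult norm_power norm_of_nat by (rule mult_left_mono) simp
      also have "\<dots> = \<bar>u\<bar> ^ 3 / 2 * (1 / real N)"
        using N by (simp add: field_simps power2_eq_square power3_eq_cube)
      also have "\<dots> \<le> exp \<bar>u\<bar> * \<bar>u\<bar> ^ 3 / 2 * (1 / real N)"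
        using N by (intro mult_right_mono divide_right_mono) (auto simp: mult_le_cancel_right1)
      finally show "norm (of_nat N ^ 2 * ?R N) \<le> exp \<bar>u\<bar> * \<bar>u\<bar> ^ 3 / 2 * (1 / real N)" .
    qed
  qed
  from tendsto_add[OF this tendsto_const[of "- complex_of_real (u\<^sup>2 / 2)"]]
  have "(\<lambda>N. of_nat N ^ 2 * ?R N + - complex_of_real (u\<^sup>2 / 2)) \<longlonglongrightarrow> - of_real (u\<^sup>2 / 2)"
    by simp
  then show ?thesis
  proof (rule Lim_transform_eventually)
    show "\<forall>\<^sub>F N in sequentially. of_nat N ^ 2 * ?R N + - complex_of_real (u\<^sup>2 / 2)
        = of_nat N ^ 2 * (cis (u / real N) - 1 - \<i> * of_real (u / real N))"
      by (rule eventually_sequentiallyI[of 1])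
        (simp add: numeral_2_eq_2 cis_conv_exp field_simps)
  qed
qed

lemma of_nat_inverse_tendsto: "(\<lambda>N. 1 / of_nat N :: complex) \<longlonglongrightarrow> 0"
  using tendsto_of_real[OF lim_1_over_n, where 'a = complex] by simp

lemma tendsto_of_scaled:
  fixes g :: "nat \<Rightarrow> complex"
  assumes "(\<lambda>N. of_nat N * (g N - c)) \<longlonglongrightarrow> D"
  shows "g \<longlonglongrightarrow> c"
proof -
  have "(\<lambda>N. 1 / of_nat N * (of_nat N * (g N - c)) + c) \<longlonglongrightarrow> 0 * D + c"
    by (intro tendsto_intros of_nat_inverse_tendsto assms)
  then have "(\<lambda>N. 1 / of_nat N * (of_nat N * (g N - c)) + c) \<longlonglongrightarrow> c" by simp
  then show ?thesis
    by (rule Lim_transform_eventually, intro eventually_sequentiallyI[of 1]) auto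
qed

lemma cis_scaled_tendsto:
  "(\<lambda>N. of_nat N * (cis (u / real N) - 1)) \<longlonglongrightarrow> \<i> * of_real u"
proof -
  have "(\<lambda>N. 1 / of_nat N * (of_nat N ^ 2 * (cis (u / real N) - 1 - \<i> * of_real (u / real N)))
      + \<i> * of_real u) \<longlonglongrightarrow> 0 * (- of_real (u\<^sup>2 / 2)) + \<i> * of_real u"
    by (intro tendsto_intros of_nat_inverse_tendsto cis_scaled2_tendsto)
  then have "(\<lambda>N. 1 / of_nat N * (of_nat N ^ 2 * (cis (u / real N) - 1 - \<i> * of_real (u / real N)))
      + \<i> * of_real u) \<longlonglongrightarrow> \<i> * of_real u" by simp
  then show ?thesis
    by (rule Lim_transform_eventually, intro eventually_sequentiallyI[of 1])
      (auto simp: field_simps power2_eq_square)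
qed

text \<open>The quantity V = A + C + A c - 1 is a factor of both diagonal deviations from 1 and of
  the lower left entry. As V has order 1/N^2, the diagonal deviations are o(1/N), while the lower
  left entry, multiplied by N^2, converges to 2 w because its cofactor tends to 2.\<close>

lemma regular_step_limits:
  fixes A C c :: "nat \<Rightarrow> complex" and \<alpha> :: real and w :: complex
  assumes A: "A \<longlonglongrightarrow> of_real \<alpha>" and C: "C \<longlonglongrightarrow> of_real (1 - \<alpha>)" and c: "c \<longlonglongrightarrow> 0"
    and W: "(\<lambda>N. of_nat N ^ 2 * (A N + C N + A N * c N - 1)) \<longlonglongrightarrow> w"
    and \<alpha>: "0 < \<alpha>"
  shows "(\<lambda>N. of_nat N * (sm11 (A N) (C N) (c N) (c N) - 1)) \<longlonglongrightarrow> 0"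
    and "(\<lambda>N. of_nat N * (sm12 (A N) (C N) (c N) (c N) / of_nat N)) \<longlonglongrightarrow> - of_real ((1 - \<alpha>) / \<alpha>)"
    and "(\<lambda>N. of_nat N * (of_nat N * sm21 (A N) (C N) (c N) (c N))) \<longlonglongrightarrow> 2 * w"
    and "(\<lambda>N. of_nat N * (sm22 (A N) (C N) (c N) (c N) - 1)) \<longlonglongrightarrow> 0"
proof -
  define V where "V N = A N + C N + A N * c N - 1" for N
  have V: "(\<lambda>N. of_nat N ^ 2 * V N) \<longlonglongrightarrow> w" using W by (simp add: V_def)
  have "(\<lambda>N. 1 / of_nat N * (of_nat N ^ 2 * V N)) \<longlonglongrightarrow> 0 * w"
    by (intro tendsto_mult of_nat_inverse_tendsto V)
  then have "(\<lambda>N. 1 / of_nat N * (of_nat N ^ 2 * V N)) \<longlonglongrightarrow> 0" by simp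
  then have V1: "(\<lambda>N. of_nat N * V N) \<longlonglongrightarrow> 0"
    by (rule Lim_transform_eventually, intro eventually_sequentiallyI[of 1])
       (auto simp: power2_eq_square)
  have D: "(\<lambda>N. 1 + C N * c N) \<longlonglongrightarrow> 1" using tendsto_add[OF tendsto_const[of 1] tendsto_mult[OF C c]] by simp
  have AD: "(\<lambda>N. A N * (1 + C N * c N)) \<longlonglongrightarrow> of_real \<alpha>" using tendsto_mult[OF A D] by simp
  have \<alpha>0: "complex_of_real \<alpha> \<noteq> 0" using \<alpha> by simp
  have ev: "\<forall>\<^sub>F N in sequentially. A N \<noteq> 0 \<and> 1 + C N * c N \<noteq> 0 \<and> 1 \<le> N"
    using tendsto_imp_eventually_ne[OF A \<alpha>0] tendsto_imp_eventually_ne[OF D, of 0] eventually_ge_at_top[of 1]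
    by (simp add: eventually_conj)
  have C': "C N = 1 + V N - A N - A N * c N" for N by (simp add: V_def)
  have 1: "sm11 (A N) (C N) (c N) (c N) - 1 = V N * ((A N - C N) / (A N * (1 + C N * c N)))"
    if "A N \<noteq> 0" "1 + C N * c N \<noteq> 0" for N
  proof -
    have "sm11 (A N) (C N) (c N) (c N) - 1
        = (A N + A N * c N + C N * (1 - C N) / A N - (1 + C N * c N)) / (1 + C N * c N)"
      using that by (simp add: sm11_def diff_divide_distrib)
    also have "\<dots> = (A N * (A N + A N * c N + C N * (1 - C N) / A N - (1 + C N * c N))) / (A N * (1 + C N * c N))"
      using that by simp
    also have "A N * (A N + A N * c N + C N * (1 - C N) / A N - (1 + C N * c N)) = V N * (A N - C N)"
      using that by (simp add: V_def field_simps)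
    finally show ?thesis by simp
  qed
  have "(\<lambda>N. of_nat N * V N * ((A N - C N) / (A N * (1 + C N * c N)))) \<longlonglongrightarrow>
      0 * ((of_real \<alpha> - of_real (1 - \<alpha>)) / of_real \<alpha>)"
    by (intro tendsto_mult V1 tendsto_divide AD tendsto_diff A C \<alpha>0)
  then show "(\<lambda>N. of_nat N * (sm11 (A N) (C N) (c N) (c N) - 1)) \<longlonglongrightarrow> 0"
    unfolding mult_zero_left
    by (rule Lim_transform_eventually) (use ev in eventually_elim, simp add: 1)
  have "(\<lambda>N. sm12 (A N) (C N) (c N) (c N)) \<longlonglongrightarrow> - (of_real \<alpha> * 0 + of_real (1 - \<alpha>) / of_real \<alpha>) / 1"
    unfolding sm12_def by (intro tendsto_intros A C c D \<alpha>0) auto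
  then have "(\<lambda>N. sm12 (A N) (C N) (c N) (c N)) \<longlonglongrightarrow> - of_real ((1 - \<alpha>) / \<alpha>)" by simp
  then show "(\<lambda>N. of_nat N * (sm12 (A N) (C N) (c N) (c N) / of_nat N)) \<longlonglongrightarrow> - of_real ((1 - \<alpha>) / \<alpha>)"
    by (rule Lim_transform_eventually) (use ev in eventually_elim, simp)
  have 3: "sm21 (A N) (C N) (c N) (c N) = V N * ((A N * (1 + c N) + 1 - C N) / (A N * (1 + C N * c N)))" for N
    unfolding sm21_def times_divide_eq_right
    by (rule arg_cong[where f = "\<lambda>x. x / _"]) (simp add: V_def algebra_simps power2_eq_square)
  have "(\<lambda>N. of_nat N ^ 2 * V N * ((A N * (1 + c N) + 1 - C N) / (A N * (1 + C N * c N)))) \<longlonglongrightarrow>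
      w * ((of_real \<alpha> * (1 + 0) + 1 - of_real (1 - \<alpha>)) / of_real \<alpha>)"
    by (intro tendsto_intros V AD A C c \<alpha>0)
  then show "(\<lambda>N. of_nat N * (of_nat N * sm21 (A N) (C N) (c N) (c N))) \<longlonglongrightarrow> 2 * w"
    using \<alpha> by (simp add: 3 power2_eq_square mult_ac)
  have 4: "sm22 (A N) (C N) (c N) (c N) - 1 = V N * (- (1 + A N * c N) / (A N * (1 + C N * c N)))"
    if "A N \<noteq> 0" "1 + C N * c N \<noteq> 0" for N
  proof -
    have "sm22 (A N) (C N) (c N) (c N) - 1
        = (1 - C N - (A N)\<^sup>2 * c N * (1 + c N) - A N * (1 + C N * c N)) / (A N * (1 + C N * c N))"
      using that by (simp add: sm22_def diff_divide_distrib)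
    also have "1 - C N - (A N)\<^sup>2 * c N * (1 + c N) - A N * (1 + C N * c N) = V N * (- (1 + A N * c N))"
      by (simp add: V_def algebra_simps power2_eq_square)
    finally show ?thesis by simp
  qed
  have "(\<lambda>N. of_nat N * V N * (- (1 + A N * c N) / (A N * (1 + C N * c N)))) \<longlonglongrightarrow>
      0 * (- (1 + of_real \<alpha> * 0) / of_real \<alpha>)"
    by (intro tendsto_intros V1 AD A C c \<alpha>0)
  then show "(\<lambda>N. of_nat N * (sm22 (A N) (C N) (c N) (c N) - 1)) \<longlonglongrightarrow> 0"
    unfolding mult_zero_left
    by (rule Lim_transform_eventually) (use ev in eventually_elim, simp add: 4)
qed

text \<open>With different neighbours \<open>cp\<close> and \<open>cm\<close> the first-order
  cancellation fails, and the lower left entry is only O(1/N). Each such matrix is applied once, so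
  the limits of its entries suffice: the identity plus a jump in the second coordinate.\<close>

lemma special_step_limits:
  fixes A C cp cm :: "nat \<Rightarrow> complex" and \<alpha> :: real and dA dC dp dm :: complex
  assumes A: "(\<lambda>N. of_nat N * (A N - of_real \<alpha>)) \<longlonglongrightarrow> dA"
    and C: "(\<lambda>N. of_nat N * (C N - of_real (1 - \<alpha>))) \<longlonglongrightarrow> dC"
    and cp: "(\<lambda>N. of_nat N * cp N) \<longlonglongrightarrow> dp" and cm: "(\<lambda>N. of_nat N * cm N) \<longlonglongrightarrow> dm"
    and \<alpha>: "0 < \<alpha>"
  shows "(\<lambda>N. sm11 (A N) (C N) (cp N) (cm N)) \<longlonglongrightarrow> 1"
    and "(\<lambda>N. sm12 (A N) (C N) (cp N) (cm N) / of_nat N) \<longlonglongrightarrow> 0"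
    and "(\<lambda>N. of_nat N * sm21 (A N) (C N) (cp N) (cm N)) \<longlonglongrightarrow> 2 * dA + 2 * dC + of_real \<alpha> * (dp + dm)"
    and "(\<lambda>N. sm22 (A N) (C N) (cp N) (cm N)) \<longlonglongrightarrow> 1"
proof -
  have A': "A \<longlonglongrightarrow> of_real \<alpha>" and C': "C \<longlonglongrightarrow> of_real (1 - \<alpha>)"
    and cp': "cp \<longlonglongrightarrow> 0" and cm': "cm \<longlonglongrightarrow> 0"
    using tendsto_of_scaled[OF A] tendsto_of_scaled[OF C] tendsto_of_scaled[of cp 0] tendsto_of_scaled[of cm 0] cp cm
    by auto
  have D: "(\<lambda>N. 1 + C N * cm N) \<longlonglongrightarrow> 1"
    using tendsto_add[OF tendsto_const[of 1] tendsto_mult[OF C' cm']] by simp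
  have AD: "(\<lambda>N. A N * (1 + C N * cm N)) \<longlonglongrightarrow> of_real \<alpha>" using tendsto_mult[OF A' D] by simp
  have \<alpha>0: "complex_of_real \<alpha> \<noteq> 0" using \<alpha> by simp
  have "(\<lambda>N. sm11 (A N) (C N) (cp N) (cm N)) \<longlonglongrightarrow>
      (of_real \<alpha> + of_real \<alpha> * 0 + of_real (1 - \<alpha>) * (1 - of_real (1 - \<alpha>)) / of_real \<alpha>) / 1"
    unfolding sm11_def by (intro tendsto_intros A' C' cp' D \<alpha>0) auto
  then show "(\<lambda>N. sm11 (A N) (C N) (cp N) (cm N)) \<longlonglongrightarrow> 1" using \<alpha> by simp
  have "(\<lambda>N. sm12 (A N) (C N) (cp N) (cm N) * (1 / of_nat N)) \<longlonglongrightarrow>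
      - (of_real \<alpha> * 0 + of_real (1 - \<alpha>) / of_real \<alpha>) / 1 * 0"
    unfolding sm12_def by (intro tendsto_intros A' C' cp' D \<alpha>0 of_nat_inverse_tendsto) auto
  then show "(\<lambda>N. sm12 (A N) (C N) (cp N) (cm N) / of_nat N) \<longlonglongrightarrow> 0" by simp
  have "(\<lambda>N. sm22 (A N) (C N) (cp N) (cm N)) \<longlonglongrightarrow>
      (1 - of_real (1 - \<alpha>) - (of_real \<alpha>)\<^sup>2 * 0 * (1 + 0)) / of_real \<alpha>"
    unfolding sm22_def by (intro tendsto_intros A' C' cp' cm' AD \<alpha>0)
  then show "(\<lambda>N. sm22 (A N) (C N) (cp N) (cm N)) \<longlonglongrightarrow> 1" using \<alpha> by simp
  have "(\<lambda>N. ((of_nat N * (A N - of_real \<alpha>)) * (A N + of_real \<alpha>)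
        + (A N)\<^sup>2 * (of_nat N * cp N + of_nat N * cm N + of_nat N * cp N * cm N)
        + (of_nat N * (C N - of_real (1 - \<alpha>))) * (1 - C N + of_real \<alpha>)) / (A N * (1 + C N * cm N)))
     \<longlonglongrightarrow> (dA * (of_real \<alpha> + of_real \<alpha>) + (of_real \<alpha>)\<^sup>2 * (dp + dm + dp * 0)
        + dC * (1 - of_real (1 - \<alpha>) + of_real \<alpha>)) / of_real \<alpha>"
    by (intro tendsto_intros A C cp cm A' C' cm' AD \<alpha>0)
  also have "(\<lambda>N. ((of_nat N * (A N - of_real \<alpha>)) * (A N + of_real \<alpha>)
        + (A N)\<^sup>2 * (of_nat N * cp N + of_nat N * cm N + of_nat N * cp N * cm N)
        + (of_nat N * (C N - of_real (1 - \<alpha>))) * (1 - C N + of_real \<alpha>)) / (A N * (1 + C N * cm N)))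
      = (\<lambda>N. of_nat N * sm21 (A N) (C N) (cp N) (cm N))"
    unfolding sm21_def times_divide_eq_right
    by (intro ext arg_cong[where f = "\<lambda>x. x / _"]) (simp add: algebra_simps power2_eq_square)
  also have "(dA * (of_real \<alpha> + of_real \<alpha>) + (of_real \<alpha>)\<^sup>2 * (dp + dm + dp * 0)
        + dC * (1 - of_real (1 - \<alpha>) + of_real \<alpha>)) / of_real \<alpha>
      = 2 * dA + 2 * dC + of_real \<alpha> * (dp + dm)"
    using \<alpha> by (simp add: field_simps power2_eq_square)
  finally show "(\<lambda>N. of_nat N * sm21 (A N) (C N) (cp N) (cm N))
      \<longlonglongrightarrow> 2 * dA + 2 * dC + of_real \<alpha> * (dp + dm)" .
qed

section \<open>Calculus of first-order expansions in 1/N\<close>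

definition expands :: "(nat \<Rightarrow> complex) \<Rightarrow> complex \<Rightarrow> complex \<Rightarrow> bool" where
  "expands g c d \<longleftrightarrow> (\<lambda>N. of_nat N * (g N - c)) \<longlonglongrightarrow> d"

lemma expands_tendsto: "expands g c d \<Longrightarrow> g \<longlonglongrightarrow> c"
  by (auto simp: expands_def intro: tendsto_of_scaled)

lemma expands_const: "expands (\<lambda>N. c) c 0"
  by (simp add: expands_def)

lemma expands_mult:
  assumes "expands g c d" "expands h c' d'"
  shows "expands (\<lambda>N. g N * h N) (c * c') (d * c' + c * d')"
proof -
  have "(\<lambda>N. (of_nat N * (g N - c)) * h N + c * (of_nat N * (h N - c'))) \<longlonglongrightarrow> d * c' + c * d'"
    using assms expands_tendsto[OF assms(2)] by (auto simp: expands_def intro!: tendsto_intros)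
  also have "(\<lambda>N. (of_nat N * (g N - c)) * h N + c * (of_nat N * (h N - c')))
      = (\<lambda>N. of_nat N * (g N * h N - c * c'))"
    by (auto simp: algebra_simps)
  finally show ?thesis by (simp add: expands_def)
qed

lemma expands_add:
  assumes "expands g c d" "expands h c' d'"
  shows "expands (\<lambda>N. g N + h N) (c + c') (d + d')"
  using tendsto_add[OF assms[unfolded expands_def]] by (simp add: expands_def algebra_simps)

lemma expands_diff:
  assumes "expands g c d" "expands h c' d'"
  shows "expands (\<lambda>N. g N - h N) (c - c') (d - d')"
  using tendsto_diff[OF assms[unfolded expands_def]] by (simp add: expands_def algebra_simps)

lemma expands_cis: "expands (\<lambda>N. cis (u / real N)) 1 (\<i> * of_real u)"
  using cis_scaled_tendsto by (simp add: expands_def)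

text \<open>For the vector on the edge {1, 2}, \<open>B\<close> and \<open>U\<close> are, up to the
  common scalar, the weighted value at 0 and the value after the first upward step. Both tend to the
  same limit, so the denominator has to be expanded to order 1/N.\<close>

lemma exit_ratio_tendsto:
  fixes p \<Delta> A C c x om :: "nat \<Rightarrow> complex" and \<alpha> :: real
  defines "q \<equiv> \<lambda>N. p N - \<Delta> N / of_nat N"
  defines "B \<equiv> \<lambda>N. (q N - C N * p N) / A N"
  defines "U \<equiv> \<lambda>N. A N * (p N + c N * q N) + C N * x N * B N"
  assumes p: "p \<longlonglongrightarrow> p0" and \<Delta>: "\<Delta> \<longlonglongrightarrow> \<Delta>0"
    and A: "expands A (of_real \<alpha>) dA" and C: "expands C (of_real (1 - \<alpha>)) dC"
    and c: "expands c 0 dc" and x: "expands x 1 dx" and om: "expands om 1 dw"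
    and crit: "2 * dA + 2 * dC + dw + of_real (1 - \<alpha>) * dx + of_real \<alpha> * dc = 0"
    and \<alpha>: "0 < \<alpha>"
  shows "B \<longlonglongrightarrow> p0" "(\<lambda>N. of_nat N * (B N - om N * U N)) \<longlonglongrightarrow> - \<Delta>0"
proof -
  have \<alpha>0: "complex_of_real \<alpha> \<noteq> 0" using \<alpha> by simp
  note lims = expands_tendsto[OF A] expands_tendsto[OF C] expands_tendsto[OF c]
    expands_tendsto[OF x] expands_tendsto[OF om]
  have "(\<lambda>N. p N - \<Delta> N * (1 / of_nat N)) \<longlonglongrightarrow> p0 - \<Delta>0 * 0"
    by (intro tendsto_intros p \<Delta> of_nat_inverse_tendsto)
  then have q: "q \<longlonglongrightarrow> p0" by (simp add: q_def)
  have "B \<longlonglongrightarrow> (p0 - of_real (1 - \<alpha>) * p0) / of_real \<alpha>"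
    unfolding B_def by (intro tendsto_intros p q lims \<alpha>0)
  then show "B \<longlonglongrightarrow> p0" using \<alpha>0 by (simp add: algebra_simps)
  \<comment> \<open>Coefficient of p in A (B - om U) after inserting q = p - \<Delta>/N. Its
    constant term cancels identically and its first-order term is -\<alpha> times the left side of
    \<open>crit\<close>, so only the \<Delta> part survives.\<close>
  define K where "K N = (1 - om N * C N * x N) * (1 - C N) - om N * (A N * A N) * (1 + c N)" for N
  have "expands K ((1 - 1 * of_real (1 - \<alpha>) * 1) * (1 - of_real (1 - \<alpha>))
        - 1 * (of_real \<alpha> * of_real \<alpha>) * (1 + 0))
      ((0 - ((dw * of_real (1 - \<alpha>) + 1 * dC) * 1 + 1 * of_real (1 - \<alpha>) * dx)) * (1 - of_real (1 - \<alpha>))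
        + (1 - 1 * of_real (1 - \<alpha>) * 1) * (0 - dC)
        - ((dw * (of_real \<alpha> * of_real \<alpha>) + 1 * (dA * of_real \<alpha> + of_real \<alpha> * dA)) * (1 + 0)
           + 1 * (of_real \<alpha> * of_real \<alpha>) * (0 + dc)))"
    unfolding K_def[abs_def]
    by (intro expands_diff expands_mult expands_add expands_const A C c x om)
  also have "(0 - ((dw * of_real (1 - \<alpha>) + 1 * dC) * 1 + 1 * of_real (1 - \<alpha>) * dx)) * (1 - of_real (1 - \<alpha>))
        + (1 - 1 * of_real (1 - \<alpha>) * 1) * (0 - dC)
        - ((dw * (of_real \<alpha> * of_real \<alpha>) + 1 * (dA * of_real \<alpha> + of_real \<alpha> * dA)) * (1 + 0)
           + 1 * (of_real \<alpha> * of_real \<alpha>) * (0 + dc))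
      = - of_real \<alpha> * (2 * dA + 2 * dC + dw + of_real (1 - \<alpha>) * dx + of_real \<alpha> * dc)"
    by (simp add: algebra_simps)
  finally have K: "(\<lambda>N. of_nat N * K N) \<longlonglongrightarrow> 0"
    unfolding crit expands_def by simp
  have "(\<lambda>N. (of_nat N * K N * p N - \<Delta> N * ((1 - om N * C N * x N) - om N * (A N * A N) * c N)) / A N)
    \<longlonglongrightarrow> (0 * p0 - \<Delta>0 * ((1 - 1 * of_real (1 - \<alpha>) * 1) - 1 * (of_real \<alpha> * of_real \<alpha>) * 0)) / of_real \<alpha>"
    by (intro tendsto_intros K p \<Delta> lims \<alpha>0)
  then have lim: "(\<lambda>N. (of_nat N * K N * p N - \<Delta> N * ((1 - om N * C N * x N) - om N * (A N * A N) * c N)) / A N)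
    \<longlonglongrightarrow> - \<Delta>0" using \<alpha>0 by simp
  have ev: "\<forall>\<^sub>F N in sequentially. A N \<noteq> 0 \<and> 1 \<le> N"
    using tendsto_imp_eventually_ne[OF lims(1) \<alpha>0] eventually_ge_at_top[of 1]
    by (simp add: eventually_conj)
  show "(\<lambda>N. of_nat N * (B N - om N * U N)) \<longlonglongrightarrow> - \<Delta>0"
  proof (rule Lim_transform_eventually[OF lim], use ev in eventually_elim)
    case (elim N)
    have AB: "A N * B N = q N - C N * p N" using elim by (simp add: B_def)
    have \<Delta>q: "\<Delta> N = of_nat N * (p N - q N)" using elim by (simp add: q_def)
    have "A N * (of_nat N * (B N - om N * U N))
        = of_nat N * ((1 - om N * C N * x N) * (A N * B N) - om N * (A N * A N) * (p N + c N * q N))"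
      unfolding U_def by (simp add: algebra_simps)
    also have "\<dots> = of_nat N * K N * p N - \<Delta> N * ((1 - om N * C N * x N) - om N * (A N * A N) * c N)"
      unfolding AB \<Delta>q K_def by (simp add: algebra_simps)
    finally show ?case using elim by (simp add: field_simps)
  qed
qed

text \<open>Coefficients of the recursion in a stratum with persistence parameter \<open>\<alpha>\<close>; the balance
  equation expresses that the centering removes the drift in every stratum.\<close>

definition sA :: "real \<Rightarrow> real \<Rightarrow> nat \<Rightarrow> complex" where
  "sA \<alpha> t N = of_real \<alpha> * cis (t / real N)"
definition sC :: "real \<Rightarrow> real \<Rightarrow> real \<Rightarrow> real \<Rightarrow> nat \<Rightarrow> complex" where
  "sC r bt \<alpha> t N = of_real (1 - \<alpha>) * cis (t * (1 + bt - r) / real N)"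
definition sc :: "real \<Rightarrow> real \<Rightarrow> real \<Rightarrow> real \<Rightarrow> nat \<Rightarrow> complex" where
  "sc r bt \<alpha> t N = of_real (1 - \<alpha>) * (cis (t * (1 - r) / real N) - cis (t * (1 + bt - r) / real N))"
definition quad :: "real \<Rightarrow> real \<Rightarrow> real \<Rightarrow> real" where
  "quad r bt \<alpha> = \<alpha> + (1 - \<alpha>) * (1 + bt - r)\<^sup>2 + \<alpha> * (1 - \<alpha>) * ((2 - r)\<^sup>2 - (2 + bt - r)\<^sup>2)"

lemma expands_sA: "expands (sA \<alpha> t) (of_real \<alpha>) (\<i> * of_real (\<alpha> * t))"
  using expands_mult[OF expands_const[of "of_real \<alpha>"] expands_cis[of t]]
  by (simp add: sA_def[abs_def] mult_ac)

lemma expands_sC: "expands (sC r bt \<alpha> t) (of_real (1 - \<alpha>)) (\<i> * of_real ((1 - \<alpha>) * (t * (1 + bt - r))))"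
  using expands_mult[OF expands_const[of "of_real (1 - \<alpha>)"] expands_cis[of "t * (1 + bt - r)"]]
  by (simp add: sC_def[abs_def] mult_ac)

lemma expands_sc: "expands (sc r bt \<alpha> t) 0 (- \<i> * of_real ((1 - \<alpha>) * (t * bt)))"
  using expands_mult[OF expands_const[of "of_real (1 - \<alpha>)"]
      expands_diff[OF expands_cis[of "t * (1 - r)"] expands_cis[of "t * (1 + bt - r)"]]]
  by (simp add: sc_def[abs_def] algebra_simps)

text \<open>Multiplied out, this is a combination of four exponentials, with frequencies 1, 1 + bt -
  r, 2 - r, 2 + bt - r in units of t/N. Its weights add up to 1 and its linear term vanishes by the
  balance equation, so the quadratic term \<open>quad\<close> remains.\<close>

lemma stratum_second_order:
  assumes "\<alpha> + (1 - \<alpha>) * (1 + bt - r) = \<alpha> * (1 - \<alpha>) * bt"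
  shows "(\<lambda>N. of_nat N ^ 2 * (sA \<alpha> t N + sC r bt \<alpha> t N + sA \<alpha> t N * sc r bt \<alpha> t N - 1))
    \<longlonglongrightarrow> - of_real (t\<^sup>2 / 2 * quad r bt \<alpha>)"
proof -
  define T where "T \<theta> N = of_nat N ^ 2 * (cis (t * \<theta> / real N) - 1 - \<i> * of_real (t * \<theta> / real N))" for \<theta> N
  have T: "T \<theta> \<longlonglongrightarrow> - of_real ((t * \<theta>)\<^sup>2 / 2)" for \<theta>
    unfolding T_def[abs_def] by (rule cis_scaled2_tendsto)
  have lim: "(\<lambda>N. of_real \<alpha> * T 1 N + of_real (1 - \<alpha>) * T (1 + bt - r) N
      + of_real (\<alpha> * (1 - \<alpha>)) * (T (2 - r) N - T (2 + bt - r) N)) \<longlonglongrightarrow>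
      of_real \<alpha> * - of_real ((t * 1)\<^sup>2 / 2) + of_real (1 - \<alpha>) * - of_real ((t * (1 + bt - r))\<^sup>2 / 2)
      + of_real (\<alpha> * (1 - \<alpha>)) * (- of_real ((t * (2 - r))\<^sup>2 / 2) - - of_real ((t * (2 + bt - r))\<^sup>2 / 2))"
    by (intro tendsto_intros T)
  have l: "of_real \<alpha> * - of_real ((t * 1)\<^sup>2 / 2) + of_real (1 - \<alpha>) * - of_real ((t * (1 + bt - r))\<^sup>2 / 2)
      + of_real (\<alpha> * (1 - \<alpha>)) * (- of_real ((t * (2 - r))\<^sup>2 / 2) - - of_real ((t * (2 + bt - r))\<^sup>2 / 2))
      = - complex_of_real (t\<^sup>2 / 2 * quad r bt \<alpha>)"
  proof -
    have "\<alpha> * - ((t * 1)\<^sup>2 / 2) + (1 - \<alpha>) * - ((t * (1 + bt - r))\<^sup>2 / 2)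
      + \<alpha> * (1 - \<alpha>) * (- ((t * (2 - r))\<^sup>2 / 2) - - ((t * (2 + bt - r))\<^sup>2 / 2)) = - (t\<^sup>2 / 2 * quad r bt \<alpha>)"
      by (simp only: quad_def power_mult_distrib) (simp add: field_simps)
    from arg_cong[OF this, of complex_of_real] show ?thesis
      by (simp only: of_real_add of_real_mult of_real_minus of_real_diff)
  qed
  have e: "sA \<alpha> t N + sC r bt \<alpha> t N + sA \<alpha> t N * sc r bt \<alpha> t N - 1 =
     of_real \<alpha> * (cis (t * 1 / real N) - 1 - \<i> * of_real (t * 1 / real N))
     + of_real (1 - \<alpha>) * (cis (t * (1 + bt - r) / real N) - 1 - \<i> * of_real (t * (1 + bt - r) / real N))
     + of_real (\<alpha> * (1 - \<alpha>)) * ((cis (t * (2 - r) / real N) - 1 - \<i> * of_real (t * (2 - r) / real N))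
       - (cis (t * (2 + bt - r) / real N) - 1 - \<i> * of_real (t * (2 + bt - r) / real N)))" for N
  proof -
    have 1: "sA \<alpha> t N * sc r bt \<alpha> t N
        = of_real (\<alpha> * (1 - \<alpha>)) * (cis (t * (2 - r) / real N) - cis (t * (2 + bt - r) / real N))"
      by (simp add: sA_def sc_def right_diff_distrib cis_mult add_divide_distrib[symmetric] algebra_simps
          flip: add_divide_distrib)
    have "of_real \<alpha> * (\<i> * of_real (t * 1 / real N))
       + of_real (1 - \<alpha>) * (\<i> * of_real (t * (1 + bt - r) / real N))
       + of_real (\<alpha> * (1 - \<alpha>)) * (\<i> * of_real (t * (2 - r) / real N) - \<i> * of_real (t * (2 + bt - r) / real N))
       = \<i> * complex_of_real (t / real N * (\<alpha> + (1 - \<alpha>) * (1 + bt - r) - \<alpha> * (1 - \<alpha>) * bt))"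
      by (simp add: field_simps add_divide_distrib diff_divide_distrib)
    also have "\<dots> = 0" by (simp add: assms)
    finally have 2: "of_real \<alpha> * (\<i> * of_real (t * 1 / real N))
       + of_real (1 - \<alpha>) * (\<i> * of_real (t * (1 + bt - r) / real N))
       + of_real (\<alpha> * (1 - \<alpha>)) * (\<i> * of_real (t * (2 - r) / real N) - \<i> * of_real (t * (2 + bt - r) / real N))
       = (0 :: complex)" .
    have 3: "of_real \<alpha> * (X1 - 1 - Y1) + of_real (1 - \<alpha>) * (X2 - 1 - Y2)
       + of_real (\<alpha> * (1 - \<alpha>)) * ((X3 - 1 - Y3) - (X4 - 1 - Y4))
       = of_real \<alpha> * X1 + of_real (1 - \<alpha>) * X2 + of_real (\<alpha> * (1 - \<alpha>)) * (X3 - X4) - 1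
         - (of_real \<alpha> * Y1 + of_real (1 - \<alpha>) * Y2 + of_real (\<alpha> * (1 - \<alpha>)) * (Y3 - Y4))"
      for X1 X2 X3 X4 Y1 Y2 Y3 Y4 :: complex
      by (simp add: algebra_simps)
    show ?thesis
      unfolding 1 unfolding sA_def sC_def 3 2 by simp
  qed
  have "of_nat N ^ 2 * (sA \<alpha> t N + sC r bt \<alpha> t N + sA \<alpha> t N * sc r bt \<alpha> t N - 1)
     = of_real \<alpha> * T 1 N + of_real (1 - \<alpha>) * T (1 + bt - r) N
      + of_real (\<alpha> * (1 - \<alpha>)) * (T (2 - r) N - T (2 + bt - r) N)" for N
    unfolding e T_def by (simp only: distrib_left right_diff_distrib mult_ac)
  with lim l show ?thesis by simp
qed

section \<open>Recursion along the bonds\<close>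

context ruin
begin

text \<open>With all weights equal to one, the flux p - q is the same across every edge, and
  crossing level j raises p by the flux times the reversal odds there. The flux equals
  \<open>no_hit 1 1\<close> because \<open>no_hit\<close> vanishes at 0.\<close>

lemma no_hit_linear:
  assumes "k < N"
  shows "no_hit 1 (int k + 1) - no_hit (-1) (int k) = no_hit 1 1
    \<and> no_hit 1 (int k + 1) = no_hit 1 1 * of_real (1 + (\<Sum>j=1..k. (1 - coef (int j)) / coef (int j)))"
  using assms
proof (induction k)
  case 0
  then show ?case by (simp add: no_hit_0)
next
  case (Suc k)
  define \<alpha> where "\<alpha> = complex_of_real (coef (int k + 1))"
  have \<alpha>: "\<alpha> \<noteq> 0" using coef_bounds[of "int k + 1"] by (simp add: \<alpha>_def)
  define p q p' q' where "p = no_hit 1 (2 + int k)" and "q = no_hit (-1) (int k + 1)"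
    and "p' = no_hit 1 (int k + 1)" and "q' = no_hit (-1) (int k)"
  have 1: "p' = \<alpha> * p + (1 - \<alpha>) * q'" "q = (1 - \<alpha>) * p + \<alpha> * q'"
    using no_hit_step[of "int k + 1" 1] no_hit_step[of "int k + 1" "-1"] Suc.prems
    by (simp_all add: p_def q_def p'_def q'_def \<alpha>_def)
  have IH: "no_hit 1 (int k + 1) - no_hit (-1) (int k) = no_hit 1 1
      \<and> no_hit 1 (int k + 1) = no_hit 1 1 * of_real (1 + (\<Sum>j=1..k. (1 - coef (int j)) / coef (int j)))"
    using Suc.IH Suc.prems by linarith
  note 2 = conjunct1[OF IH, folded p'_def q'_def] conjunct2[OF IH, folded p'_def]
  have "p' - q' = \<alpha> * (p - q')" "p - q = \<alpha> * (p - q')"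
    unfolding 1 by (simp_all add: algebra_simps)
  then have "p - q = no_hit 1 1" "\<alpha> * (p - q') = no_hit 1 1"
    using 2(1) by simp_all
  then have 3: "p - q = no_hit 1 1" "p - q' = no_hit 1 1 / \<alpha>"
    using \<alpha> by (simp_all add: eq_divide_eq mult.commute)
  have "p = p' + (1 - \<alpha>) * (p - q')" unfolding 1 by (simp add: algebra_simps)
  also have "\<dots> = no_hit 1 1 * (of_real (1 + (\<Sum>j=1..k. (1 - coef (int j)) / coef (int j))) + (1 - \<alpha>) / \<alpha>)"
    unfolding 3(2) 2(2) using \<alpha> by (simp add: field_simps)
  also have "\<dots> = no_hit 1 1 * of_real (1 + (\<Sum>j=1..Suc k. (1 - coef (int j)) / coef (int j)))"
    by (simp add: \<alpha>_def add.commute)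
  finally show ?case using 3(1) by (simp add: p_def q_def add.commute)
qed

lemma no_hit_eq:
  assumes "1 \<le> f" "f < N"
  shows "no_hit 1 1 = of_real (1 / (1 + (real f - 1) * ((1 - a) / a) + (real N - real f) * ((1 - b) / b)))"
proof -
  define ka kb where "ka = (1 - a) / a" and "kb = (1 - b) / b"
  have k: "(1 - coef (int j)) / coef (int j) = (if j < f then ka else kb)" for j
    by (simp add: gr_coef_def ka_def kb_def)
  have "(\<Sum>j=1..n. (1 - coef (int j)) / coef (int j))
      = (if n < f then real n * ka else (real f - 1) * ka + (real n - real f + 1) * kb)" for n
    unfolding k
  proof (induction n)
    case (Suc n)
    consider "Suc n < f" | "Suc n = f" | "f \<le> n" by linarith
    then show ?case
    proof cases
      case 2
      then show ?thesis using 2[symmetric] Suc by (simp add: algebra_simps)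
    qed (use Suc in \<open>simp_all add: algebra_simps\<close>)
  qed (use assms in simp)
  from this[of "N - 1"] assms
  have s: "(\<Sum>j=1..N - 1. (1 - coef (int j)) / coef (int j))
      = (real f - 1) * ((1 - a) / a) + (real N - real f) * ((1 - b) / b)"
    by (auto simp: of_nat_diff ka_def kb_def)
  have pos: "0 < 1 + ((real f - 1) * ((1 - a) / a) + (real N - real f) * ((1 - b) / b))"
    using assms ab by (intro add_pos_nonneg add_nonneg_nonneg mult_nonneg_nonneg) auto
  have "no_hit 1 (int N) = no_hit 1 1 * of_real (1 + (\<Sum>j=1..N - 1. (1 - coef (int j)) / coef (int j)))"
    using no_hit_linear[of "N - 1"] assms by (simp add: of_nat_diff)
  moreover have "no_hit 1 (int N) = 1" using no_hit_exit[of 1] assms by simp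
  ultimately have e: "no_hit 1 1 * of_real (1 + ((real f - 1) * ((1 - a) / a) + (real N - real f) * ((1 - b) / b))) = 1"
    unfolding s by simp
  have "no_hit 1 1 = 1 / of_real (1 + ((real f - 1) * ((1 - a) / a) + (real N - real f) * ((1 - b) / b)))"
    using e pos by (intro eq_divide_imp) (auto simp del: of_real_add simp: of_real_eq_0_iff)
  then show ?thesis by (simp add: add.assoc)
qed

end

definition smul :: "complex \<Rightarrow> complex \<times> complex \<Rightarrow> complex \<times> complex" where
  "smul c v = (c * fst v, c * snd v)"

lemma step_map_smul: "step_map N A C cp cm (smul c v) = smul c (step_map N A C cp cm v)"
  by (simp add: step_map_def lin2_def smul_def algebra_simps)

lemma funpow_step_map_smul: "(step_map N A C cp cm ^^ n) (smul c v) = smul c ((step_map N A C cp cm ^^ n) v)"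
  by (induction n) (simp_all add: step_map_smul)

context ruin_weight
begin

definition cA :: "int \<Rightarrow> complex" where "cA k = of_real (coef k) * z"
definition cC :: "int \<Rightarrow> complex" where "cC k = of_real (1 - coef k) * (x * z * y)"
definition cc :: "int \<Rightarrow> complex" where "cc k = of_real (1 - coef k) * (z * y - x * z * y)"

lemma run_up_eq: "0 < k \<Longrightarrow> k < int N \<Longrightarrow>
    run True 1 k = cA k * run False 1 (k + 1) + cC k * run True (-1) (k - 1)"
  by (simp add: run_step_up[of k] cA_def cC_def xw_def)

lemma run_down_eq: "0 < k \<Longrightarrow> k < int N \<Longrightarrow>
    run True (-1) k = cA k * run False (-1) (k - 1) + cC k * run True 1 (k + 1)"
  by (simp add: run_step_down[of k] cA_def cC_def xw_def)

text \<open>The two flags give different values only if the next step reverses: the older run then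
  lacks the factor \<open>x\<close> of a short run.\<close>

lemma run_up_stale: "0 < k \<Longrightarrow> k < int N \<Longrightarrow>
    run False 1 k = run True 1 k + cc k * run True (-1) (k - 1)"
  by (simp add: run_step_up[of k] cc_def xw_def algebra_simps)

lemma run_down_stale: "0 < k \<Longrightarrow> k < int N \<Longrightarrow>
    run False (-1) k = run True (-1) k + cc k * run True 1 (k + 1)"
  by (simp add: run_step_down[of k] cc_def xw_def algebra_simps)

definition bond :: "int \<Rightarrow> complex \<times> complex" where
  "bond k = (run True 1 (k + 1), of_nat N * (run True 1 (k + 1) - run True (-1) k))"

text \<open>The values with flag False at k + 1 and k - 1 are eliminated by
  \<open>run_up_stale\<close> and \<open>run_down_stale\<close>. Hence the neighbouring
  coefficients, and the range of k, which keeps both neighbours strictly between 0 and N.\<close>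

lemma bond_step:
  assumes "2 \<le> k" "k \<le> int N - 2" "cA k \<noteq> 0" "1 + cC k * cc (k - 1) \<noteq> 0"
  shows "bond (k - 1) = step_map N (cA k) (cC k) (cc (k + 1)) (cc (k - 1)) (bond k)"
  unfolding bond_def
  using assms run_up_eq[of k] run_down_eq[of k] run_up_stale[of "k + 1"] run_down_stale[of "k - 1"]
  by (intro step_map_eq[where q' = "run True (-1) (k - 1)" and p' = "run True 1 (k - 1 + 1)", THEN trans[rotated]])
    (auto simp: mult_ac)

text \<open>A path inside an excursion that reaches N contributes nothing, so at N - 1 the upward
  value is a multiple of the downward one. This fixes the direction of the top vector; with second
  component normalised to 1, the first has order 1/N.\<close>

lemma bond_top:
  assumes "3 \<le> N" "cC (int N - 1) \<noteq> 1"
  shows "bond (int N - 2) = smul (of_nat N * (cC (int N - 1) - 1) * run True (-1) (int N - 2))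
    (cC (int N - 1) / (of_nat N * (cC (int N - 1) - 1)), 1)"
proof -
  have "run True 1 (int N - 1) = cC (int N - 1) * run True (-1) (int N - 2)"
    using run_up_eq[of "int N - 1"] run_exit[of False 1] assms by simp
  moreover define C K d where "C = cC (int N - 1)" and "K = of_nat N * (C - 1)"
    and "d = run True (-1) (int N - 2)"
  moreover have "K \<noteq> 0" using assms by (simp add: K_def C_def)
  then have "K * d * (C / K) = C * d" by simp
  moreover have "K * d = of_nat N * (C * d - d)" by (simp add: K_def algebra_simps)
  moreover have "int N - 2 + 1 = int N - 1" by simp
  ultimately show ?thesis by (simp only: bond_def smul_def fst_conv snd_conv mult_1_right)
qed

text \<open>Level 1 is separate because a downward step from it ends the excursion. With F =
  \<open>full 1 0\<close>, its equations are w F = \<sigma> B and \<open>run True 1 1\<close> =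
  \<sigma> U. Inserting them into F = \<open>no_hit 1 1\<close> + z y \<open>run True 1 1\<close>
  and multiplying by B removes \<sigma> without dividing by it.\<close>

lemma bond_bottom:
  assumes "3 \<le> N" "bond 1 = smul \<sigma> v" "cA 1 \<noteq> 0"
  defines "q \<equiv> fst v - snd v / of_nat N"
  defines "B \<equiv> (q - cC 1 * fst v) / cA 1"
  defines "U \<equiv> cA 1 * (fst v + cc 2 * q) + cC 1 * x * B"
  shows "full 1 0 * (B - w * z * y * U) = no_hit 1 1 * B"
proof -
  have p: "run True 1 2 = \<sigma> * fst v"
    using arg_cong[OF assms(2), of fst] by (simp add: bond_def smul_def)
  have "of_nat N * (run True 1 2 - run True (-1) 1) = \<sigma> * snd v"
    using arg_cong[OF assms(2), of snd] by (simp add: bond_def smul_def)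
  then have "run True 1 2 - run True (-1) 1 = \<sigma> * snd v / of_nat N"
    using assms(1) by (simp add: field_simps)
  then have q: "run True (-1) 1 = \<sigma> * q"
    using p by (simp add: q_def algebra_simps)
  have "\<sigma> * q = cA 1 * (w * full 1 0) + cC 1 * (\<sigma> * fst v)"
    using run_down_eq[of 1] run_0[of False "-1"] assms(1) p q full_0[of 1] full_0[of "-1"]
    by (simp add: xw_def)
  then have wF: "w * full 1 0 = \<sigma> * B"
    using assms(3) by (simp add: B_def field_simps)
  have "run True 1 1 = cA 1 * (\<sigma> * fst v + cc 2 * (\<sigma> * q)) + cC 1 * (x * (w * full 1 0))"
    using run_up_eq[of 1] run_up_stale[of 2] run_0[of True "-1"] assms(1) p q full_0[of 1] full_0[of "-1"]
    by (simp add: xw_def mult_ac)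
  then have "run True 1 1 = \<sigma> * U"
    unfolding wF U_def by (simp add: algebra_simps)
  then have "full 1 0 = no_hit 1 1 + z * y * (\<sigma> * U)"
    using full_0[of 1] assms(1) by simp
  then have "full 1 0 * B = no_hit 1 1 * B + z * y * U * (\<sigma> * B)"
    by (simp add: algebra_simps)
  also have "\<sigma> * B = w * full 1 0" using wF by simp
  finally show ?thesis by (simp add: algebra_simps)
qed

end

section \<open>The limit for the process started at the origin\<close>

context ruin_weight
begin

definition qA :: "real \<Rightarrow> complex" where "qA \<alpha> = of_real \<alpha> * z"
definition qC :: "real \<Rightarrow> complex" where "qC \<alpha> = of_real (1 - \<alpha>) * (x * z * y)"
definition qc :: "real \<Rightarrow> complex" where "qc \<alpha> = of_real (1 - \<alpha>) * (z * y - x * z * y)"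

lemma c_eq_q: "cA k = qA (coef k)" "cC k = qC (coef k)" "cc k = qc (coef k)"
  by (simp_all add: cA_def cC_def cc_def qA_def qC_def qc_def)

lemma coef_inner: "k < int f \<Longrightarrow> coef k = a" and coef_outer: "int f \<le> k \<Longrightarrow> coef k = b"
  by (simp_all add: gr_coef_def)

definition v0 :: "complex \<times> complex" where "v0 = (qC b / (of_nat N * (qC b - 1)), 1)"

text \<open>Read from the inside: N - 2 - f outer steps lead from the edge at N - 2 to that at f,
  the mixed steps at k = f and k = f - 1 to that at f - 2, and f - 3 inner steps to that at
  1.\<close>

definition v1 :: "complex \<times> complex" where
  "v1 = (step_map N (qA a) (qC a) (qc a) (qc a) ^^ (f - 3))
     (step_map N (qA a) (qC a) (qc b) (qc a)
       (step_map N (qA b) (qC b) (qc b) (qc a)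
         ((step_map N (qA b) (qC b) (qc b) (qc b) ^^ (N - 2 - f)) v0)))"

lemma bond_chain:
  assumes f: "3 \<le> f" "f + 2 \<le> N"
    and nz: "1 + qC a * qc a \<noteq> 0" "1 + qC b * qc b \<noteq> 0" "1 + qC b * qc a \<noteq> 0" "qC b \<noteq> 1"
  shows "\<exists>\<sigma>. bond 1 = smul \<sigma> v1"
proof -
  have z0: "qA a \<noteq> 0" "qA b \<noteq> 0" using ab by (simp_all add: qA_def z_def)
  have outer: "bond (int N - 2 - int j) = (step_map N (qA b) (qC b) (qc b) (qc b) ^^ j) (bond (int N - 2))"
    if "j \<le> N - 2 - f" for j
    using that
  proof (induction j)
    case (Suc j)
    let ?k = "int N - 2 - int j"
    have c: "coef ?k = b" "coef (?k + 1) = b" "coef (?k - 1) = b"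
      using Suc.prems f by (auto intro!: coef_outer)
    have "bond (?k - 1) = step_map N (qA b) (qC b) (qc b) (qc b) (bond ?k)"
      using bond_step[of ?k, unfolded c_eq_q c] Suc.prems f nz z0 by simp
    then show ?case using Suc by (simp add: algebra_simps)
  qed simp
  have inner: "bond (int f - 2 - int j) = (step_map N (qA a) (qC a) (qc a) (qc a) ^^ j) (bond (int f - 2))"
    if "j \<le> f - 3" for j
    using that
  proof (induction j)
    case (Suc j)
    let ?k = "int f - 2 - int j"
    have c: "coef ?k = a" "coef (?k + 1) = a" "coef (?k - 1) = a"
      by (auto intro!: coef_inner)
    have "bond (?k - 1) = step_map N (qA a) (qC a) (qc a) (qc a) (bond ?k)"
      using bond_step[of ?k, unfolded c_eq_q c] Suc.prems f nz z0 by simp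
    then show ?case using Suc by (simp add: algebra_simps)
  qed simp
  have cf: "coef (int f) = b" "coef (int f + 1) = b" "coef (int f - 1) = a" "coef (int f - 1 + 1) = b"
    "coef (int f - 1 - 1) = a" "coef (int N - 1) = b"
    using f by (auto intro!: coef_outer coef_inner)
  have "bond (int f - 1) = step_map N (qA b) (qC b) (qc b) (qc a) (bond (int f))"
    using bond_step[of "int f", unfolded c_eq_q cf] f nz z0 by simp
  moreover have "bond (int f - 2) = step_map N (qA a) (qC a) (qc b) (qc a) (bond (int f - 1))"
    using bond_step[of "int f - 1", unfolded c_eq_q cf] f nz z0 by simp
  moreover have "bond (int N - 2) = smul (of_nat N * (qC b - 1) * run True (-1) (int N - 2)) v0"
    using bond_top[unfolded c_eq_q cf] f nz unfolding v0_def by simp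
  moreover have "bond (int f) = (step_map N (qA b) (qC b) (qc b) (qc b) ^^ (N - 2 - f)) (bond (int N - 2))"
    using outer[of "N - 2 - f"] f by (simp add: of_nat_diff)
  moreover have "bond 1 = (step_map N (qA a) (qC a) (qc a) (qc a) ^^ (f - 3)) (bond (int f - 2))"
    using inner[of "f - 3"] f by (simp add: of_nat_diff)
  ultimately have "bond 1 = smul (of_nat N * (qC b - 1) * run True (-1) (int N - 2)) v1"
    by (simp only: v1_def step_map_smul funpow_step_map_smul)
  then show ?thesis by blast
qed

lemma q_eq:
  assumes "s = t / real N"
  shows "qA \<alpha> = sA \<alpha> t N" "qC \<alpha> = sC r bt \<alpha> t N" "qc \<alpha> = sc r bt \<alpha> t N"
    and "x = cis (t * bt / real N)" "w * z * y = cis (t * (1 - r - g) / real N)"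
proof -
  have xzy: "x * z * y = cis (t * (1 + bt - r) / real N)" "z * y = cis (t * (1 - r) / real N)"
    unfolding x_def y_def z_def unfolding assms
    by (simp_all add: cis_mult) (simp_all add: algebra_simps add_divide_distrib diff_divide_distrib)
  show "x = cis (t * bt / real N)" "w * z * y = cis (t * (1 - r - g) / real N)"
    unfolding x_def y_def z_def w_def unfolding assms
    by (simp_all add: cis_mult) (simp_all add: algebra_simps add_divide_distrib diff_divide_distrib)
  show "qA \<alpha> = sA \<alpha> t N" "qC \<alpha> = sC r bt \<alpha> t N" "qc \<alpha> = sc r bt \<alpha> t N"
    unfolding qA_def qC_def qc_def xzy sA_def sC_def sc_def unfolding z_def unfolding assms by simp_all
qed

lemma full_chain:
  assumes "3 \<le> f" "f + 2 \<le> N"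
    and "1 + qC a * qc a \<noteq> 0" "1 + qC b * qc b \<noteq> 0" "1 + qC b * qc a \<noteq> 0" "qC b \<noteq> 1"
  defines "q \<equiv> fst v1 - snd v1 / of_nat N"
  defines "B \<equiv> (q - qC a * fst v1) / qA a"
  defines "U \<equiv> qA a * (fst v1 + qc a * q) + qC a * x * B"
  shows "full 1 0 * (B - w * z * y * U) = no_hit 1 1 * B"
proof -
  obtain \<sigma> where "bond 1 = smul \<sigma> v1" using bond_chain assms by blast
  moreover have "coef 1 = a" "coef 2 = a" using assms(1) by (auto intro!: coef_inner)
  moreover have "qA a \<noteq> 0" using ab by (simp_all add: qA_def z_def)
  ultimately show ?thesis
    using bond_bottom[of \<sigma> v1] assms by (simp add: c_eq_q)
qed

end

lemma no_hit_scaled_tendsto: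
  fixes f :: "nat \<Rightarrow> nat"
  assumes ab: "0 < a" "a < 1" "0 < b" "b < 1"
    and f: "\<forall>N\<ge>2. 1 \<le> f N \<and> f N < N"
    and lim: "(\<lambda>N. real (f N) / real N) \<longlonglongrightarrow> \<eta>" and \<eta>: "0 < \<eta>" "\<eta> < 1"
  shows "(\<lambda>N. of_nat N * ruin.no_hit a b (f N) N 1 1)
    \<longlonglongrightarrow> of_real (1 / (\<eta> * ((1 - a) / a) + (1 - \<eta>) * ((1 - b) / b)))"
proof -
  let ?ka = "(1 - a) / a" and ?kb = "(1 - b) / b"
  have "0 < \<eta> * ?ka + (1 - \<eta>) * ?kb"
    using ab \<eta> by (intro add_pos_pos mult_pos_pos) auto
  then have "(\<lambda>N. 1 / (1 / real N + (real (f N) / real N - 1 / real N) * ?ka + (1 - real (f N) / real N) * ?kb))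
      \<longlonglongrightarrow> 1 / (0 + (\<eta> - 0) * ?ka + (1 - \<eta>) * ?kb)"
    by (intro tendsto_divide tendsto_const tendsto_add tendsto_mult tendsto_diff lim lim_1_over_n) auto
  then have "(\<lambda>N. complex_of_real (1 / (1 / real N + (real (f N) / real N - 1 / real N) * ?ka
        + (1 - real (f N) / real N) * ?kb))) \<longlonglongrightarrow> of_real (1 / (\<eta> * ?ka + (1 - \<eta>) * ?kb))"
    by (intro tendsto_of_real) simp
  then show ?thesis
  proof (rule Lim_transform_eventually, intro eventually_sequentiallyI[of 2])
    fix N :: nat assume N: "2 \<le> N"
    have ru: "ruin a b" using ab by unfold_locales
    have "real N * (1 / (1 + (real (f N) - 1) * ?ka + (real N - real (f N)) * ?kb))
        = 1 / ((1 + (real (f N) - 1) * ?ka + (real N - real (f N)) * ?kb) / real N)"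
      by simp
    also have "(1 + (real (f N) - 1) * ?ka + (real N - real (f N)) * ?kb) / real N
        = 1 / real N + (real (f N) / real N - 1 / real N) * ?ka + (1 - real (f N) / real N) * ?kb"
      using N by (simp add: add_divide_distrib diff_divide_distrib left_diff_distrib)
    finally show "complex_of_real (1 / (1 / real N + (real (f N) / real N - 1 / real N) * ?ka
        + (1 - real (f N) / real N) * ?kb)) = of_nat N * ruin.no_hit a b (f N) N 1 1"
      unfolding ruin.no_hit_eq[OF ru conjunct1[OF f[rule_format, OF N]] conjunct2[OF f[rule_format, OF N]]]
      by (metis of_real_mult of_real_of_nat_eq)
  qed
qed

section \<open>Identities between the constants\<close>

lemma sig_pos:
  fixes a b :: real
  assumes "0 < a" "a < 1" "0 < b" "b < 1"
  shows "0 < a + b\<^sup>2 - 2 * a * b"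
proof -
  have "a + b\<^sup>2 - 2 * a * b = a * (1 - a) + (b - a)\<^sup>2"
    by (simp add: power2_eq_square algebra_simps)
  moreover have "0 < a * (1 - a)" using assms by simp
  ultimately show ?thesis by (simp add: add_pos_nonneg)
qed

text \<open>The origin of \<sigma>1 and \<sigma>2: multiplied by the reversal odds of its stratum,
  \<open>quad\<close> becomes \<sigma>1^2 / (1 - b)^2 for the inner and \<sigma>2^2 / (1 - a)^2 for
  the outer stratum, the squares of the hyperbolic rates per unit t.\<close>

lemma quad_eq:
  assumes "\<alpha> < 1" "\<beta> < 1"
  shows "quad ((2 - \<alpha> - \<beta>) / ((1 - \<alpha>) * (1 - \<beta>))) (1 / ((1 - \<alpha>) * (1 - \<beta>))) \<alpha>
    = \<alpha> * (\<alpha> + \<beta>\<^sup>2 - 2 * \<alpha> * \<beta>) / ((1 - \<alpha>) * (1 - \<beta>)\<^sup>2)"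
proof -
  define u v where "u = 1 - \<alpha>" and "v = 1 - \<beta>"
  have uv: "u \<noteq> 0" "v \<noteq> 0" "\<alpha> = 1 - u" "\<beta> = 1 - v" "2 - \<alpha> - \<beta> = u + v" using assms by (auto simp: u_def v_def)
  have 1: "1 + 1 / (u * v) - (u + v) / (u * v) = (u * v + 1 - (u + v)) / (u * v)"
    "2 - (u + v) / (u * v) = (2 * (u * v) - (u + v)) / (u * v)"
    "2 + 1 / (u * v) - (u + v) / (u * v) = (2 * (u * v) + 1 - (u + v)) / (u * v)"
    using uv by (simp_all add: add_divide_distrib diff_divide_distrib)
  have "quad ((u + v) / (u * v)) (1 / (u * v)) \<alpha> = (\<alpha> * (u * v)\<^sup>2 + u * (u * v + 1 - (u + v))\<^sup>2
      + \<alpha> * u * ((2 * (u * v) - (u + v))\<^sup>2 - (2 * (u * v) + 1 - (u + v))\<^sup>2)) / (u * v)\<^sup>2"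
    unfolding quad_def 1 power_divide using uv
    by (simp add: add_divide_distrib diff_divide_distrib right_diff_distrib flip: u_def)
  also have "\<alpha> * (u * v)\<^sup>2 + u * (u * v + 1 - (u + v))\<^sup>2
      + \<alpha> * u * ((2 * (u * v) - (u + v))\<^sup>2 - (2 * (u * v) + 1 - (u + v))\<^sup>2)
      = u * (\<alpha> * (\<alpha> + \<beta>\<^sup>2 - 2 * \<alpha> * \<beta>))"
    unfolding uv(3,4) by (simp add: power2_eq_square algebra_simps)
  also have "u * (\<alpha> * (\<alpha> + \<beta>\<^sup>2 - 2 * \<alpha> * \<beta>)) / (u * v)\<^sup>2 = \<alpha> * (\<alpha> + \<beta>\<^sup>2 - 2 * \<alpha> * \<beta>) / (u * v\<^sup>2)"
    using uv by (simp add: power2_eq_square)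
  finally show ?thesis by (simp add: u_def v_def uv(5) flip: u_def v_def)
qed

lemma balance:
  fixes \<alpha> \<beta> :: real
  assumes "\<alpha> < 1" "\<beta> < 1"
  shows "\<alpha> + (1 - \<alpha>) * (1 + 1 / ((1 - \<alpha>) * (1 - \<beta>)) - (2 - \<alpha> - \<beta>) / ((1 - \<alpha>) * (1 - \<beta>)))
    = \<alpha> * (1 - \<alpha>) * (1 / ((1 - \<alpha>) * (1 - \<beta>)))"
proof -
  define u v where "u = 1 - \<alpha>" and "v = 1 - \<beta>"
  have uv: "u \<noteq> 0" "v \<noteq> 0" "\<alpha> = 1 - u" "\<beta> = 1 - v" using assms by (auto simp: u_def v_def)
  show ?thesis unfolding uv(3,4) using uv(1,2) by (simp add: field_simps)
qed

text \<open>The two components of the limit vector are the two transforms: \<open>snd v\<close> is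
  the reciprocal of \<open>psi_hat\<close>, and \<open>fst v\<close>, times minus the limit of N
  times the escape probability, is the reciprocal of \<open>phi_hat\<close>.\<close>

lemma psi_phi_eq:
  fixes a b \<eta> t :: real
  assumes ab: "0 < a" "a < 1" "0 < b" "b < 1" and \<eta>: "0 < \<eta>" "\<eta> < 1"
  defines "r \<equiv> (2 - a - b) / ((1 - a) * (1 - b))" and "bt \<equiv> 1 / ((1 - a) * (1 - b))"
  defines "\<mu>a \<equiv> t * sig1 a b / (1 - b)" and "\<mu>b \<equiv> t * sig2 a b / (1 - a)"
    and "ka \<equiv> (1 - a) / a" and "kb \<equiv> (1 - b) / b"
  defines "v \<equiv> flow \<mu>a ka (- (t\<^sup>2 * quad r bt a)) \<eta>
      (lin2 1 0 (- \<i> * of_real (t * bt * (b - a)\<^sup>2)) 1 (flow \<mu>b kb (- (t\<^sup>2 * quad r bt b)) (1 - \<eta>) (0, 1)))"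
  shows "ka * - (t\<^sup>2 * quad r bt a) = - \<mu>a\<^sup>2" "kb * - (t\<^sup>2 * quad r bt b) = - \<mu>b\<^sup>2" "snd v \<noteq> 0"
    and "of_real (1 / (\<eta> * ka + (1 - \<eta>) * kb)) * fst v / (- snd v) = psi_hat a b \<eta> t / phi_hat a b \<eta> t"
proof -
  define s1 s2 where "s1 = sig1 a b" and "s2 = sig2 a b"
  have sg: "0 < a + b\<^sup>2 - 2 * a * b" "0 < b + a\<^sup>2 - 2 * a * b"
    using sig_pos[of a b] sig_pos[of b a] ab by (simp_all add: mult_ac)
  have s1: "0 < s1" "s1\<^sup>2 = a + b\<^sup>2 - 2 * a * b" and s2: "0 < s2" "s2\<^sup>2 = b + a\<^sup>2 - 2 * a * b"
    using sg by (simp_all add: s1_def s2_def sig1_def sig2_def)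
  define u w where "u = 1 - a" and "w = 1 - b"
  have uw: "0 < u" "0 < w" using ab by (simp_all add: u_def w_def)
  have qa: "quad r bt a = a * s1\<^sup>2 / (u * w\<^sup>2)"
    using quad_eq[of a b] ab by (simp add: r_def bt_def s1 u_def w_def)
  have qb: "quad r bt b = b * s2\<^sup>2 / (w * u\<^sup>2)"
    using quad_eq[of b a] ab by (simp add: r_def bt_def s2 u_def w_def mult.commute[of "1 - a" "1 - b"] algebra_simps)
  have m: "\<mu>a = t * s1 / w" "\<mu>b = t * s2 / u" by (simp_all add: \<mu>a_def \<mu>b_def s1_def s2_def u_def w_def)
  have k: "ka = u / a" "kb = w / b" by (simp_all add: ka_def kb_def u_def w_def)
  show g1: "ka * - (t\<^sup>2 * quad r bt a) = - \<mu>a\<^sup>2"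
    unfolding qa m k using uw ab by (simp add: power_mult_distrib power_divide)
  show "kb * - (t\<^sup>2 * quad r bt b) = - \<mu>b\<^sup>2"
    unfolding qb m k using uw ab by (simp add: power_mult_distrib power_divide)
  define Ca Sa Cb Sb where "Ca = cosh (\<mu>a * \<eta>)" and "Sa = shc \<mu>a \<eta>"
    and "Cb = cosh (\<mu>b * (1 - \<eta>))" and "Sb = shc \<mu>b (1 - \<eta>)"
  define J where "J = t * bt * (b - a)\<^sup>2"
  have fv: "fst v = - Complex (kb * Ca * Sb + ka * Sa * Cb) (ka * kb * J * Sa * Sb)"
    by (simp add: v_def flow_def lin2_def J_def[symmetric] complex_eq_iff
        flip: Ca_def Sa_def Cb_def Sb_def)
  have sv: "snd v = Complex (Ca * Cb + t\<^sup>2 * quad r bt a * kb * Sa * Sb) (J * kb * Ca * Sb)"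
    by (simp add: v_def flow_def lin2_def J_def[symmetric] complex_eq_iff
        flip: Ca_def Sa_def Cb_def Sb_def)
  have sh: "0 \<le> shc \<mu> \<theta>" if "0 \<le> \<theta>" for \<mu> \<theta>
    using that by (cases \<mu> "0 :: real" rule: linorder_cases)
      (auto simp: shc_def mult_nonpos_nonneg intro: divide_nonpos_neg)
  have "0 \<le> quad r bt a" "0 \<le> kb" using uw ab by (auto simp: qa k)
  \<comment> \<open>The real part of \<open>snd v\<close> is a positive plus a nonnegative term, for
    either sign of t, since \<open>shc\<close> is even in its rate.\<close>
  then have "0 < Ca * Cb + t\<^sup>2 * quad r bt a * kb * Sa * Sb"
    unfolding Sa_def Sb_def Ca_def Cb_def using \<eta>
    by (intro add_pos_nonneg mult_pos_pos mult_nonneg_nonneg sh) auto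
  then show nz: "snd v \<noteq> 0" by (auto simp: sv complex_eq_iff)
  have shm: "sinh (\<mu> * \<theta>) = \<mu> * shc \<mu> \<theta>" for \<mu> \<theta> by (simp add: shc_def)
  have kk: "kap1 a b \<eta> * t = \<mu>a * \<eta>" "kap2 a b \<eta> * t = \<mu>b * (1 - \<eta>)"
    by (simp_all add: kap1_def kap2_def \<mu>a_def \<mu>b_def)
  have psi: "psi_hat a b \<eta> t = 1 / snd v"
  proof -
    have e: "complex_of_real (a * b * s1 * s2 * Ca * Cb + a\<^sup>2 * s1\<^sup>2 * (\<mu>a * Sa) * (\<mu>b * Sb))
        + \<i> * complex_of_real (a * s1 * (b - a)\<^sup>2 * Ca * (\<mu>b * Sb)) = of_real (a * b * s1 * s2) * snd v"
    proof -
      have "a\<^sup>2 * s1\<^sup>2 * (\<mu>a * Sa) * (\<mu>b * Sb) = a * b * s1 * s2 * (t\<^sup>2 * quad r bt a * kb * Sa * Sb)"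
        unfolding m qa k using uw ab by (simp add: field_simps power2_eq_square)
      moreover have "a * s1 * (b - a)\<^sup>2 * Ca * (\<mu>b * Sb) = a * b * s1 * s2 * (J * kb * Ca * Sb)"
        unfolding m k J_def bt_def u_def[symmetric] w_def[symmetric] using uw ab by (simp add: field_simps)
      ultimately show ?thesis by (simp add: sv complex_eq_iff algebra_simps)
    qed
    show ?thesis
      unfolding psi_hat_def kk shm s1_def[symmetric] s2_def[symmetric] Ca_def[symmetric] Sa_def[symmetric]
        Cb_def[symmetric] Sb_def[symmetric] e
      using ab s1 s2 by simp
  qed
  have kpos: "0 < ka" "0 < kb" using uw ab by (simp_all add: k)
  have zpos: "0 < \<eta> * ka + (1 - \<eta>) * kb" using kpos \<eta> by (simp add: add_pos_pos)
  have phi: "1 / phi_hat a b \<eta> t = - of_real (1 / (\<eta> * ka + (1 - \<eta>) * kb)) * fst v"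
  proof (cases "t = 0")
    \<comment> \<open>Both rates vanish here and \<open>shc\<close> becomes the identity, so the
      value prescribed for \<open>phi_hat\<close> at 0 matches the flow.\<close>
    case True
    then show ?thesis
      using zpos by (simp add: phi_hat_def fv complex_eq_iff m Ca_def Cb_def Sa_def Sb_def shc_def J_def algebra_simps)
  next
    case False
    have "complex_of_real (a * s1 * Ca * (\<mu>b * Sb) + b * s2 * (\<mu>a * Sa) * Cb)
        + \<i> * complex_of_real ((b - a)\<^sup>2 * (\<mu>a * Sa) * (\<mu>b * Sb)) = - of_real (t * s1 * s2 / (ka * kb)) * fst v"
    proof -
      have "a * s1 * Ca * (\<mu>b * Sb) + b * s2 * (\<mu>a * Sa) * Cb = t * s1 * s2 / (ka * kb) * (kb * Ca * Sb + ka * Sa * Cb)"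
        unfolding m k using uw ab by (simp add: field_simps)
      moreover have "(b - a)\<^sup>2 * (\<mu>a * Sa) * (\<mu>b * Sb) = t * s1 * s2 / (ka * kb) * (ka * kb * J * Sa * Sb)"
        unfolding m k J_def bt_def u_def[symmetric] w_def[symmetric] using uw ab by (simp add: field_simps power2_eq_square)
      ultimately show ?thesis by (simp only: fv) (simp add: complex_eq_iff)
    qed
    moreover have "(b * kap1 a b \<eta> * s2 + a * kap2 a b \<eta> * s1) * t = t * s1 * s2 / (ka * kb) * (\<eta> * ka + (1 - \<eta>) * kb)"
      unfolding kap1_def kap2_def s1_def[symmetric] s2_def[symmetric] u_def[symmetric] w_def[symmetric] k
      using uw ab by (simp add: field_simps)
    moreover have "t * s1 * s2 / (ka * kb) \<noteq> 0" using False s1 s2 kpos by simp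
    moreover have "1 / (complex_of_real (c * d) / (- of_real c * q)) = - of_real (1 / d) * q" if "c \<noteq> 0" "d \<noteq> 0" for c d q
      using that by simp
    ultimately show ?thesis
      unfolding phi_hat_def kk shm s1_def[symmetric] s2_def[symmetric] Ca_def[symmetric] Sa_def[symmetric]
        Cb_def[symmetric] Sb_def[symmetric]
      using False zpos by simp
  qed
  have "psi_hat a b \<eta> t / phi_hat a b \<eta> t = psi_hat a b \<eta> t * (1 / phi_hat a b \<eta> t)" by simp
  also have "\<dots> = of_real (1 / (\<eta> * ka + (1 - \<eta>) * kb)) * fst v / (- snd v)"
    unfolding psi phi by simp
  finally show "of_real (1 / (\<eta> * ka + (1 - \<eta>) * kb)) * fst v / (- snd v) = psi_hat a b \<eta> t / phi_hat a b \<eta> t" ..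
qed

text \<open>The reversal odds: minus the upper right entry of the generator in a stratum, and at the
  same time the relative growth of \<open>no_hit\<close> per level.\<close>

definition kap :: "real \<Rightarrow> real" where "kap \<alpha> = (1 - \<alpha>) / \<alpha>"

lemma full_tendsto:
  fixes a b \<eta> t \<mu>a \<mu>b :: real and f :: "nat \<Rightarrow> nat"
  assumes ab: "0 < a" "a < 1" "0 < b" "b < 1"
    and f: "\<forall>N\<ge>2. 1 \<le> f N \<and> f N < N"
    and lim: "(\<lambda>N. real (f N) / real N) \<longlonglongrightarrow> \<eta>" and \<eta>: "0 < \<eta>" "\<eta> < 1"
  defines "r \<equiv> (2 - a - b) / ((1 - a) * (1 - b))" and "bt \<equiv> 1 / ((1 - a) * (1 - b))"
    and "g \<equiv> a * (b - a) / ((1 - a) * (1 - b))"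
  assumes \<mu>a: "kap a * - (t\<^sup>2 * quad r bt a) = - \<mu>a\<^sup>2" and \<mu>b: "kap b * - (t\<^sup>2 * quad r bt b) = - \<mu>b\<^sup>2"
    and v: "v = flow \<mu>a (kap a) (- (t\<^sup>2 * quad r bt a)) \<eta>
      (lin2 1 0 (- \<i> * of_real (t * bt * (b - a)\<^sup>2)) 1 (flow \<mu>b (kap b) (- (t\<^sup>2 * quad r bt b)) (1 - \<eta>) (0, 1)))"
    and nz: "snd v \<noteq> 0"
  shows "(\<lambda>N. ruin_weight.full a b (f N) N (t / real N) r bt g 1 0)
    \<longlonglongrightarrow> of_real (1 / (\<eta> * kap a + (1 - \<eta>) * kap b)) * fst v / (- snd v)"
proof -
  let ?A = "\<lambda>\<alpha>. sA \<alpha> t" and ?C = "\<lambda>\<alpha>. sC r bt \<alpha> t" and ?c = "\<lambda>\<alpha>. sc r bt \<alpha> t"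
  have bal: "a + (1 - a) * (1 + bt - r) = a * (1 - a) * bt" "b + (1 - b) * (1 + bt - r) = b * (1 - b) * bt"
    using balance[of a b] balance[of b a] ab by (simp_all add: r_def bt_def mult.commute algebra_simps)
  \<comment> \<open>\<open>V0\<close> to \<open>V4\<close> follow the construction of
    \<open>v1\<close> and sit at the edges N - 2, f, f - 1, f - 2 and 1.\<close>
  define V0 where "V0 N = (?C b N / (of_nat N * (?C b N - 1)), 1 :: complex)" for N
  define V1 where "V1 N = (step_map N (?A b N) (?C b N) (?c b N) (?c b N) ^^ (N - 2 - f N)) (V0 N)" for N
  define V2 where "V2 N = step_map N (?A b N) (?C b N) (?c b N) (?c a N) (V1 N)" for N
  define V3 where "V3 N = step_map N (?A a N) (?C a N) (?c b N) (?c a N) (V2 N)" for N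
  define V4 where "V4 N = (step_map N (?A a N) (?C a N) (?c a N) (?c a N) ^^ (f N - 3)) (V3 N)" for N
  note A = expands_sA[of _ t] and C = expands_sC[of r bt _ t] and c = expands_sc[of r bt _ t]
  note A' = expands_tendsto[OF A] and C' = expands_tendsto[OF C] and c' = expands_tendsto[OF c]
  have f_large: "\<forall>\<^sub>F N in sequentially. 3 \<le> f N \<and> f N + 2 \<le> N"
  proof -
    have "\<forall>\<^sub>F N in sequentially. \<eta> / 2 < real (f N) / real N"
      "\<forall>\<^sub>F N in sequentially. real (f N) / real N < (1 + \<eta>) / 2"
      using order_tendstoD(1)[OF lim, of "\<eta> / 2"] order_tendstoD(2)[OF lim, of "(1 + \<eta>) / 2"] \<eta> by auto
    \<comment> \<open>From f > \<eta> N / 2 the first term yields f > 3; from N - f > (1 - \<eta>) N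
      / 2 the second yields N - f > 2.\<close>
    moreover have "\<forall>\<^sub>F N in sequentially. 6 / \<eta> + 4 / (1 - \<eta>) \<le> real N"
      by (rule eventually_compose_filterlim[OF eventually_ge_at_top filterlim_real_sequentially])
    ultimately show ?thesis
      using eventually_gt_at_top[of 0]
    proof eventually_elim
      case (elim N)
      have "6 / \<eta> \<le> real N" "4 / (1 - \<eta>) \<le> real N"
        using elim(3) \<eta> divide_nonneg_pos[of 6 \<eta>] divide_nonneg_pos[of 4 "1 - \<eta>"] by linarith+
      then have "6 \<le> real N * \<eta>" "4 \<le> real N * (1 - \<eta>)"
        using \<eta> by (simp_all add: divide_le_eq)
      moreover have "\<eta> * real N < 2 * real (f N)" "2 * real (f N) < (1 + \<eta>) * real N"
        using elim by (simp_all add: field_simps)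
      ultimately have "3 < real (f N)" "real (f N) + 2 < real N"
        by (simp_all add: algebra_simps)
      then show ?case by linarith
    qed
  qed
  have nb: "(\<lambda>N. real (N - 2 - f N) / real N) \<longlonglongrightarrow> 1 - \<eta>"
  proof (rule Lim_transform_eventually)
    have "(\<lambda>N. 1 - 2 * (1 / real N) - real (f N) / real N) \<longlonglongrightarrow> 1 - 2 * 0 - \<eta>"
      by (intro tendsto_intros lim lim_1_over_n)
    then show "(\<lambda>N. 1 - 2 * (1 / real N) - real (f N) / real N) \<longlonglongrightarrow> 1 - \<eta>" by simp
    show "\<forall>\<^sub>F N in sequentially. 1 - 2 * (1 / real N) - real (f N) / real N = real (N - 2 - f N) / real N"
      using f_large by eventually_elim (auto simp: of_nat_diff field_simps)
  qed
  have na: "(\<lambda>N. real (f N - 3) / real N) \<longlonglongrightarrow> \<eta>"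
  proof (rule Lim_transform_eventually)
    have "(\<lambda>N. real (f N) / real N - 3 * (1 / real N)) \<longlonglongrightarrow> \<eta> - 3 * 0"
      by (intro tendsto_intros lim lim_1_over_n)
    then show "(\<lambda>N. real (f N) / real N - 3 * (1 / real N)) \<longlonglongrightarrow> \<eta>" by simp
    show "\<forall>\<^sub>F N in sequentially. real (f N) / real N - 3 * (1 / real N) = real (f N - 3) / real N"
      using f_large by eventually_elim (auto simp: of_nat_diff field_simps)
  qed
  have zone: "(\<lambda>N. (step_map N (?A \<alpha> N) (?C \<alpha> N) (?c \<alpha> N) (?c \<alpha> N) ^^ n N) (u N))
      \<longlonglongrightarrow> flow \<mu> (kap \<alpha>) (- (t\<^sup>2 * quad r bt \<alpha>)) L l"
    if "0 < \<alpha>" "\<alpha> + (1 - \<alpha>) * (1 + bt - r) = \<alpha> * (1 - \<alpha>) * bt"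
      "kap \<alpha> * - (t\<^sup>2 * quad r bt \<alpha>) = - \<mu>\<^sup>2" "(\<lambda>N. real (n N) / real N) \<longlonglongrightarrow> L" "u \<longlonglongrightarrow> l"
    for \<alpha> \<mu> n L u l
  proof -
    note R = regular_step_limits[OF A' C' c' stratum_second_order[OF that(2)] that(1)]
    show ?thesis
      unfolding step_map_def
    proof (rule funpow_lin2_tendsto[OF that(3) R(1) _ _ R(4) that(4,5)])
      show "(\<lambda>N. of_nat N * (sm12 (?A \<alpha> N) (?C \<alpha> N) (?c \<alpha> N) (?c \<alpha> N) / of_nat N))
          \<longlonglongrightarrow> - of_real (kap \<alpha>)"
        using R(2) by (simp add: kap_def)
      show "(\<lambda>N. of_nat N * (of_nat N * sm21 (?A \<alpha> N) (?C \<alpha> N) (?c \<alpha> N) (?c \<alpha> N)))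
          \<longlonglongrightarrow> of_real (- (t\<^sup>2 * quad r bt \<alpha>))"
        using R(3) by simp
    qed
  qed
  \<comment> \<open>Both mixed matrices have b above and a below. The balance equation for \<alpha>
    simplifies the jump, whose sign depends on \<alpha>: it is i t bt b (a - b) at f and i t bt a (b
    - a) at f - 1.\<close>
  have special: "(\<lambda>N. step_map N (?A \<alpha> N) (?C \<alpha> N) (?c b N) (?c a N) (u N))
      \<longlonglongrightarrow> lin2 1 0 (\<i> * of_real (t * bt * \<alpha> * (a + b - 2 * \<alpha>))) 1 l"
    if "0 < \<alpha>" "\<alpha> + (1 - \<alpha>) * (1 + bt - r) = \<alpha> * (1 - \<alpha>) * bt" "u \<longlonglongrightarrow> l"
    for \<alpha> u l
  proof -
    note S = special_step_limits[OF A[of \<alpha>, unfolded expands_def] C[of \<alpha>, unfolded expands_def]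
        c[of b, unfolded expands_def diff_0_right] c[of a, unfolded expands_def diff_0_right] that(1)]
    have "t * bt * \<alpha> * (a + b - 2 * \<alpha>) = 2 * t * (\<alpha> * (1 - \<alpha>) * bt) - \<alpha> * ((1 - b) * (t * bt) + (1 - a) * (t * bt))"
      by (simp add: algebra_simps)
    also have "\<dots> = 2 * (\<alpha> * t) + 2 * ((1 - \<alpha>) * (t * (1 + bt - r)))
        - \<alpha> * ((1 - b) * (t * bt) + (1 - a) * (t * bt))"
      unfolding that(2)[symmetric] by (simp only: distrib_left mult_ac)
    finally have j: "t * bt * \<alpha> * (a + b - 2 * \<alpha>) = 2 * (\<alpha> * t) + 2 * ((1 - \<alpha>) * (t * (1 + bt - r)))
        - \<alpha> * ((1 - b) * (t * bt) + (1 - a) * (t * bt))" .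
    have "2 * (\<i> * of_real (\<alpha> * t)) + 2 * (\<i> * of_real ((1 - \<alpha>) * (t * (1 + bt - r))))
        + of_real \<alpha> * (- \<i> * of_real ((1 - b) * (t * bt)) + - \<i> * of_real ((1 - a) * (t * bt)))
        = \<i> * complex_of_real (t * bt * \<alpha> * (a + b - 2 * \<alpha>))"
      unfolding j by (simp add: complex_eq_iff) (simp add: algebra_simps)
    with S(3) have "(\<lambda>N. of_nat N * sm21 (?A \<alpha> N) (?C \<alpha> N) (?c b N) (?c a N))
        \<longlonglongrightarrow> \<i> * of_real (t * bt * \<alpha> * (a + b - 2 * \<alpha>))" by metis
    then show ?thesis
      unfolding step_map_def by (intro tendsto_lin2 S that(3))
  qed
  have "(\<lambda>N. ?C b N / (?C b N - 1) * (1 / of_nat N)) \<longlonglongrightarrow> of_real (1 - b) / (of_real (1 - b) - 1) * 0"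
    using ab by (intro tendsto_intros C' of_nat_inverse_tendsto) auto
  then have V0: "V0 \<longlonglongrightarrow> (0, 1)"
    unfolding V0_def[abs_def] by (intro tendsto_Pair tendsto_const) (simp add: mult.commute)
  note V1 = zone[OF ab(3) bal(2) \<mu>b nb V0, folded V1_def]
  note V2 = special[OF ab(3) bal(2) V1, folded V2_def]
  note V3 = special[OF ab(1) bal(1) V2, folded V3_def]
  \<comment> \<open>The two jumps have opposite signs but sizes proportional to b and a, so they
    leave the net amount -(b - a)^2.\<close>
  have "lin2 1 0 (\<i> * of_real (t * bt * a * (a + b - 2 * a))) 1 (lin2 1 0 (\<i> * of_real (t * bt * b * (a + b - 2 * b))) 1 l)
      = lin2 1 0 (- \<i> * of_real (t * bt * (b - a)\<^sup>2)) 1 l" for l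
  proof -
    have "t * bt * (b - a)\<^sup>2 = - (t * bt * a * (a + b - 2 * a) + t * bt * b * (a + b - 2 * b))"
      by (simp add: algebra_simps power2_eq_square)
    then show ?thesis by (simp only: lin2_def) (simp add: algebra_simps)
  qed
  note V3' = V3[unfolded this]
  have V4: "V4 \<longlonglongrightarrow> v"
    using zone[OF ab(1) bal(1) \<mu>a na V3', folded V4_def] by (simp add: v V4_def[abs_def])
  let ?x = "\<lambda>N. cis (t * bt / real N)" and ?om = "\<lambda>N. cis (t * (1 - r - g) / real N)"
  define q where "q N = fst (V4 N) - snd (V4 N) / of_nat N" for N
  define B where "B N = (q N - ?C a N * fst (V4 N)) / ?A a N" for N
  define U where "U N = ?A a N * (fst (V4 N) + ?c a N * q N) + ?C a N * ?x N * B N" for N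
  \<comment> \<open>After the balance equation for a is inserted, this is linear in g and holds
    exactly for the chosen coefficient of the number of excursions.\<close>
  have crit: "2 * (\<i> * of_real (a * t)) + 2 * (\<i> * of_real ((1 - a) * (t * (1 + bt - r))))
      + \<i> * of_real (t * (1 - r - g)) + of_real (1 - a) * (\<i> * of_real (t * bt))
      + of_real a * (- \<i> * of_real ((1 - a) * (t * bt))) = 0"
  proof -
    have "2 * (a * (1 - a) * bt) + (1 - r - g) + (1 - a) * bt - a * ((1 - a) * bt) = 0"
    proof -
      define u w where "u = 1 - a" and "w = 1 - b"
      have uw: "u \<noteq> 0" "w \<noteq> 0" "a = 1 - u" "b = 1 - w" using ab by (auto simp: u_def w_def)
      show ?thesis unfolding bt_def r_def g_def unfolding uw(3,4) using uw(1,2)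
        by (simp add: field_simps)
    qed
    then have "t * (2 * (a + (1 - a) * (1 + bt - r)) + (1 - r - g) + (1 - a) * bt - a * ((1 - a) * bt)) = 0"
      unfolding bal(1) by simp
    then have "2 * (a * t) + 2 * ((1 - a) * (t * (1 + bt - r))) + t * (1 - r - g) + (1 - a) * (t * bt)
        - a * ((1 - a) * (t * bt)) = 0"
      by (simp add: algebra_simps)
    from arg_cong[OF this, of "\<lambda>y. \<i> * complex_of_real y"] show ?thesis
      by (simp add: complex_eq_iff)
  qed
  note ex = exit_ratio_tendsto[OF tendsto_fst[OF V4] tendsto_snd[OF V4] A C c expands_cis expands_cis crit ab(1),
      folded q_def, folded B_def, folded U_def]
  note Z = no_hit_scaled_tendsto[OF ab f lim \<eta>, folded kap_def]
  have "(\<lambda>N. of_nat N * ruin.no_hit a b (f N) N 1 1 * B N / (of_nat N * (B N - ?om N * U N)))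
      \<longlonglongrightarrow> of_real (1 / (\<eta> * kap a + (1 - \<eta>) * kap b)) * fst v / (- snd v)"
    using nz by (intro tendsto_divide tendsto_mult[OF Z] ex) simp_all
  moreover have "\<forall>\<^sub>F N in sequentially. of_nat N * ruin.no_hit a b (f N) N 1 1 * B N / (of_nat N * (B N - ?om N * U N))
      = ruin_weight.full a b (f N) N (t / real N) r bt g 1 0"
  proof -
    have e1: "\<forall>\<^sub>F N in sequentially. 1 + ?C \<alpha> N * ?c \<beta> N \<noteq> 0" for \<alpha> \<beta>
      using tendsto_add[OF tendsto_const[of 1] tendsto_mult[OF C'[of \<alpha>] c'[of \<beta>]]]
      by (intro tendsto_imp_eventually_ne) auto
    have e2: "\<forall>\<^sub>F N in sequentially. ?C b N \<noteq> 1"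
      using ab by (intro tendsto_imp_eventually_ne[OF C']) auto
    \<comment> \<open>The identity from \<open>full_chain\<close> is a product; division is
      legitimate for large N because the denominator tends to -\<open>snd v\<close>, which is
      nonzero.\<close>
    have e3: "\<forall>\<^sub>F N in sequentially. of_nat N * (B N - ?om N * U N) \<noteq> 0"
      using nz by (intro tendsto_imp_eventually_ne[OF ex(2)]) auto
    show ?thesis
      using e1[of a a] e1[of b b] e1[of b a] e2 e3 f_large
    proof eventually_elim
      case (elim N)
      have rw: "ruin_weight a b" using ab by unfold_locales
      note Q = ruin_weight.q_eq[OF rw refl]
      have v1: "ruin_weight.v1 a b (f N) N (t / real N) r bt = V4 N"
        unfolding ruin_weight.v1_def[OF rw] ruin_weight.v0_def[OF rw] Q V4_def V3_def V2_def V1_def V0_def ..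
      have "ruin_weight.full a b (f N) N (t / real N) r bt g 1 0 * (B N - ?om N * U N)
          = ruin.no_hit a b (f N) N 1 1 * B N"
        using ruin_weight.full_chain[OF rw, of "f N" N "t / real N" r bt g, unfolded Q v1] elim
        by (simp add: B_def U_def q_def)
      then show ?case using elim by (simp add: divide_eq_eq mult_ac)
    qed
  qed
  ultimately show ?thesis by (rule Lim_transform_eventually)
qed

section \<open>Independence of the starting point\<close>

text \<open>In the limit the recursion forces affine growth in \<open>k\<close>, which boundedness excludes unless
  the slope vanishes.\<close>

lemma bounded_recursion_tendsto:
  fixes p q :: "nat \<Rightarrow> nat \<Rightarrow> complex" and z :: "nat \<Rightarrow> complex" and a :: real
  assumes z: "z \<longlonglongrightarrow> 1" and a: "0 < a" "a < 1"
    and p: "\<And>N k. norm (p N k) \<le> 1" and q: "\<And>N k. norm (q N k) \<le> 1"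
    and rec: "\<And>k. \<forall>\<^sub>F N in sequentially. p N k = of_real a * z N * p N (Suc k) + of_real (1 - a) * z N * q N k
      \<and> q N (Suc k) = of_real (1 - a) * z N * p N (Suc k) + of_real a * z N * q N k"
  shows "(\<lambda>N. p N k - q N 0) \<longlonglongrightarrow> 0" "(\<lambda>N. q N k - q N 0) \<longlonglongrightarrow> 0"
proof -
  define \<kappa> where "\<kappa> = complex_of_real ((1 - a) / a)"
  define D where "D N = p N 0 - q N 0" for N
  \<comment> \<open>\<open>P\<close> and \<open>Q\<close> are the deviations from the affine
    solution of the recursion with z = 1 that has the same initial values and slope proportional to
    \<open>D\<close>.\<close>
  define P where "P k N = p N k - q N 0 - D N * (1 + of_nat k * \<kappa>)" for k N
  define Q where "Q k N = q N k - q N 0 - D N * (of_nat k * \<kappa>)" for k N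
  have a\<kappa>: "of_real a * \<kappa> = 1 - of_real a" "1 + \<kappa> = 1 / of_real a" using a by (simp_all add: \<kappa>_def field_simps)
  have null: "(\<lambda>N. h N * u N) \<longlonglongrightarrow> 0" if "h \<longlonglongrightarrow> 0" "\<And>N. norm (u N) \<le> 1" for h u :: "nat \<Rightarrow> complex"
  proof (rule Lim_null_comparison[OF _ tendsto_norm_zero[OF that(1)]])
    show "\<forall>\<^sub>F N in sequentially. norm (h N * u N) \<le> norm (h N)"
      using that(2) by (simp add: norm_mult mult_left_le)
  qed
  have "P k \<longlonglongrightarrow> 0 \<and> Q k \<longlonglongrightarrow> 0" for k
  proof (induction k)
    case 0
    then show ?case by (simp add: P_def[abs_def] Q_def[abs_def] D_def)
  next
    case (Suc k)
    then have IH: "P k \<longlonglongrightarrow> 0" "Q k \<longlonglongrightarrow> 0" by auto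
    have "(\<lambda>N. (1 / z N - 1) / of_real a) \<longlonglongrightarrow> (1 / 1 - 1) / of_real a"
      using a by (intro tendsto_intros z) auto
    then have n1: "(\<lambda>N. (1 / z N - 1) / of_real a * p N k) \<longlonglongrightarrow> 0" by (intro null p) simp
    have ev: "\<forall>\<^sub>F N in sequentially. z N \<noteq> 0" using z by (rule tendsto_imp_eventually_ne) simp
    have "(\<lambda>N. P k N * (1 + \<kappa>) - \<kappa> * Q k N + (1 / z N - 1) / of_real a * p N k) \<longlonglongrightarrow> 0 * (1 + \<kappa>) - \<kappa> * 0 + 0"
      by (intro tendsto_intros IH n1)
    then have "(\<lambda>N. P k N * (1 + \<kappa>) - \<kappa> * Q k N + (1 / z N - 1) / of_real a * p N k) \<longlonglongrightarrow> 0" by simp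
    then have P': "P (Suc k) \<longlonglongrightarrow> 0"
    proof (rule Lim_transform_eventually, use ev rec[of k] in eventually_elim)
      case (elim N)
      have "p N k = of_real a * z N * p N (Suc k) + (of_real a * \<kappa>) * z N * q N k"
        using conjunct1[OF elim(2)] unfolding a\<kappa>(1) by simp
      then have "p N k / (of_real a * z N) = p N (Suc k) + \<kappa> * q N k"
        using elim(1) a by (simp add: divide_eq_eq algebra_simps)
      moreover have "p N k / (of_real a * z N) = p N k / of_real a + (1 / z N - 1) / of_real a * p N k"
        using elim(1) a by (simp add: field_simps)
      ultimately have "p N (Suc k) = p N k / of_real a - \<kappa> * q N k + (1 / z N - 1) / of_real a * p N k"
        by (simp add: algebra_simps)
      then have e: "p N (Suc k) = (1 + \<kappa>) * p N k - \<kappa> * q N k + (1 / z N - 1) / of_real a * p N k"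
        by (simp add: a\<kappa>)
      show ?case unfolding P_def Q_def e by (simp add: algebra_simps)
    qed
    have "(\<lambda>N. (z N - 1) * of_real (1 - a)) \<longlonglongrightarrow> (1 - 1) * of_real (1 - a)"
      "(\<lambda>N. (z N - 1) * of_real a) \<longlonglongrightarrow> (1 - 1) * of_real a"
      by (intro tendsto_intros z)+
    then have n2: "(\<lambda>N. (z N - 1) * of_real (1 - a) * p N (Suc k)) \<longlonglongrightarrow> 0"
      and n3: "(\<lambda>N. (z N - 1) * of_real a * q N k) \<longlonglongrightarrow> 0"
      by (auto intro!: null p q)
    have "(\<lambda>N. of_real (1 - a) * P (Suc k) N + of_real a * Q k N + ((z N - 1) * of_real (1 - a) * p N (Suc k)
        + (z N - 1) * of_real a * q N k)) \<longlonglongrightarrow> of_real (1 - a) * 0 + of_real a * 0 + (0 + 0)"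
      by (intro tendsto_intros P' IH n2 n3)
    then have "(\<lambda>N. of_real (1 - a) * P (Suc k) N + of_real a * Q k N + ((z N - 1) * of_real (1 - a) * p N (Suc k)
        + (z N - 1) * of_real a * q N k)) \<longlonglongrightarrow> 0" by simp
    then have "Q (Suc k) \<longlonglongrightarrow> 0"
    proof (rule Lim_transform_eventually, use rec[of k] in eventually_elim)
      case (elim N)
      have "of_real (1 - a) * (1 + of_nat (Suc k) * \<kappa>) + of_real a * (of_nat k * \<kappa>)
          = (1 - of_real a) + of_nat (Suc k) * \<kappa> - of_real a * \<kappa>"
        by (simp add: algebra_simps)
      also have "\<dots> = of_nat (Suc k) * \<kappa>" by (simp add: a\<kappa>)
      finally have e: "of_nat (Suc k) * \<kappa> = of_real (1 - a) * (1 + of_nat (Suc k) * \<kappa>) + of_real a * (of_nat k * \<kappa>)" ..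
      have "Q (Suc k) N = q N (Suc k) - q N 0
          - D N * (of_real (1 - a) * (1 + of_nat (Suc k) * \<kappa>) + of_real a * (of_nat k * \<kappa>))"
        unfolding Q_def e[symmetric] ..
      also have "\<dots> = of_real (1 - a) * P (Suc k) N + of_real a * Q k N + ((z N - 1) * of_real (1 - a) * p N (Suc k)
        + (z N - 1) * of_real a * q N k)"
        unfolding conjunct2[OF elim] P_def Q_def by (simp only: of_real_diff of_real_1 distrib_left
            left_diff_distrib right_diff_distrib distrib_right) (simp add: algebra_simps)
      finally show ?case ..
    qed
    with P' show ?case by simp
  qed
  then have PQ: "P k \<longlonglongrightarrow> 0" "Q k \<longlonglongrightarrow> 0" for k by auto
  have D: "D \<longlonglongrightarrow> 0"
  proof (rule LIMSEQ_I)
    fix \<epsilon> :: real assume \<epsilon>: "0 < \<epsilon>"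
    \<comment> \<open>The values p N k and q N 0 and the deviation P k N are each at most 1 in norm,
      which explains the 3: at a level this high a difference \<open>D\<close> of size \<epsilon>
      would exceed their sum.\<close>
    obtain k :: nat where k: "3 * a / ((1 - a) * \<epsilon>) < real k" using reals_Archimedean2 by blast
    define c where "c = 1 + real k * ((1 - a) / a)"
    have c: "0 < c" "3 < c * \<epsilon>"
    proof -
      have "3 * a < real k * ((1 - a) * \<epsilon>)" using k a \<epsilon> by (simp add: divide_less_eq)
      then have "3 < real k * ((1 - a) / a) * \<epsilon>" using a by (simp add: field_simps)
      then show "3 < c * \<epsilon>" using \<epsilon> by (simp add: c_def distrib_right)
      show "0 < c" using a by (simp add: c_def add_pos_nonneg)
    qed
    obtain N0 where N0: "\<And>N. N \<ge> N0 \<Longrightarrow> norm (P k N) < 1"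
      using LIMSEQ_D[OF PQ(1)[of k], of 1] by auto
    show "\<exists>N0. \<forall>N\<ge>N0. norm (D N - 0) < \<epsilon>"
    proof (intro exI allI impI)
      fix N assume N: "N0 \<le> N"
      have "norm (D N) * c = norm (D N * (1 + of_nat k * \<kappa>))"
      proof -
        have "1 + of_nat k * \<kappa> = complex_of_real c" by (simp add: c_def \<kappa>_def)
        then show ?thesis using c by (simp add: norm_mult del: of_real_add)
      qed
      also have "D N * (1 + of_nat k * \<kappa>) = p N k - q N 0 - P k N" by (simp add: P_def)
      also have "norm \<dots> \<le> norm (p N k) + norm (q N 0) + norm (P k N)"
        by (meson norm_triangle_ineq4 norm_triangle_le_diff order_trans add_right_mono)
      also have "\<dots> < 3" using p[of N k] q[of N 0] N0[OF N] by linarith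
      also have "\<dots> < \<epsilon> * c" using c by (simp add: mult.commute)
      finally show "norm (D N - 0) < \<epsilon>" using c by simp
    qed
  qed
  have "(\<lambda>N. P k N + D N * (1 + of_nat k * \<kappa>)) \<longlonglongrightarrow> 0 + 0 * (1 + of_nat k * \<kappa>)"
    by (intro tendsto_intros PQ D)
  then show "(\<lambda>N. p N k - q N 0) \<longlonglongrightarrow> 0" by (simp add: P_def)
  have "(\<lambda>N. Q k N + D N * (of_nat k * \<kappa>)) \<longlonglongrightarrow> 0 + 0 * (of_nat k * \<kappa>)"
    by (intro tendsto_intros PQ D)
  then show "(\<lambda>N. q N k - q N 0) \<longlonglongrightarrow> 0" by (simp add: Q_def)
qed

context ruin
begin

text \<open>Adding the odds of both strata bounds each summand wherever its level lies, so the
  constant depends neither on f nor on N. Escape from a fixed level is thus as unlikely as escape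
  from 1.\<close>

lemma norm_no_hit_le:
  assumes "k < N"
  defines "K \<equiv> 1 + real k * ((1 - a) / a + (1 - b) / b)"
  shows "norm (no_hit 1 (int k + 1)) \<le> K * norm (no_hit 1 1)"
    and "norm (no_hit (-1) (int k)) \<le> (K + 1) * norm (no_hit 1 1)"
proof -
  have bd: "0 \<le> (1 - coef (int j)) / coef (int j)" "(1 - coef (int j)) / coef (int j) \<le> (1 - a) / a + (1 - b) / b" for j
    using ab by (auto simp: gr_coef_def)
  have "(\<Sum>j=1..k. (1 - coef (int j)) / coef (int j)) \<le> real (card {1..k}) * ((1 - a) / a + (1 - b) / b)"
    by (intro sum_bounded_above bd)
  moreover have "0 \<le> (\<Sum>j=1..k. (1 - coef (int j)) / coef (int j))" by (intro sum_nonneg bd)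
  ultimately have n: "norm (complex_of_real (1 + (\<Sum>j=1..k. (1 - coef (int j)) / coef (int j)))) \<le> K"
    unfolding norm_of_real by (simp add: K_def)
  show 1: "norm (no_hit 1 (int k + 1)) \<le> K * norm (no_hit 1 1)"
    unfolding conjunct2[OF no_hit_linear[OF assms(1)]] norm_mult
    using mult_right_mono[OF n, of "norm (no_hit 1 1)"] by (simp only: mult.commute norm_ge_zero)
  have "no_hit (-1) (int k) = no_hit 1 (int k + 1) - no_hit 1 1"
    using conjunct1[OF no_hit_linear[OF assms(1)]] by (simp add: algebra_simps)
  then have "norm (no_hit (-1) (int k)) \<le> norm (no_hit 1 (int k + 1)) + norm (no_hit 1 1)"
    by (simp add: norm_triangle_ineq4)
  with 1 show "norm (no_hit (-1) (int k)) \<le> (K + 1) * norm (no_hit 1 1)"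
    by (simp add: distrib_right)
qed

end

text \<open>Before the first visit to 0 only time accumulates. A path that never gets there has last
  visit time 0 by convention, hence weight 1, and contributes its bare probability.\<close>

lemma (in ruin_weight) esum_lin_Cons:
  assumes "m \<noteq> 0" "e = 1 \<or> e = -1"
  shows "esum e (m + e) (\<lambda>es. cis (s * lin m (e # es))) = z * hit e (m + e) + no_hit e (m + e)"
proof -
  have "(\<lambda>es. cis (s * lin m (e # es))) = (\<lambda>es. z * (if gr_hits (m + e) es then cis (s * lin (m + e) es) else 0)
      + (if gr_hits (m + e) es then 0 else 1))"
    using assms by (auto simp: gr_lin_Cons z_def cis_mult algebra_simps fun_eq_iff)
  then have "esum e (m + e) (\<lambda>es. cis (s * lin m (e # es))) =
      esum e (m + e) (\<lambda>es. z * (if gr_hits (m + e) es then cis (s * lin (m + e) es) else 0)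
      + (if gr_hits (m + e) es then 0 else 1))" by simp
  also have "\<dots> = z * hit e (m + e) + no_hit e (m + e)"
    unfolding hit_def no_hit_def esum_cmult[symmetric]
    using assms by (intro esum_add) (auto simp: z_def norm_mult)
  finally show ?thesis .
qed

context ruin_weight
begin

text \<open>Below the interface the persistence is a, so for a fixed edge and large N the first-step
  equations have the form required by \<open>bounded_recursion_tendsto\<close>.\<close>

lemma hit_rec:
  assumes "Suc j < f" "Suc j < N"
  shows "hit 1 (int j + 1) = of_real a * z * hit 1 (int (Suc j) + 1) + of_real (1 - a) * z * hit (-1) (int j)"
    and "hit (-1) (int (Suc j)) = of_real (1 - a) * z * hit 1 (int (Suc j) + 1) + of_real a * z * hit (-1) (int j)"
proof -
  have "coef (int j + 1) = a" using assms by (auto intro!: coef_inner)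
  then show "hit 1 (int j + 1) = of_real a * z * hit 1 (int (Suc j) + 1) + of_real (1 - a) * z * hit (-1) (int j)"
    and "hit (-1) (int (Suc j)) = of_real (1 - a) * z * hit 1 (int (Suc j) + 1) + of_real a * z * hit (-1) (int j)"
    using hit_step[of "int j + 1" 1] hit_step[of "int j + 1" "-1"] assms by (simp_all add: add.commute)
qed

lemma hit_0_eq: "0 < N \<Longrightarrow> hit (-1) 0 = full 1 0"
  using hit_0[of "-1"] full_0[of 1] full_0[of "-1"] by simp

context
  fixes t :: real
  assumes param: "s = t / real N" "r = (2 - a - b) / ((1 - a) * (1 - b))" "bt = 1 / ((1 - a) * (1 - b))"
    "g = a * (b - a) / ((1 - a) * (1 - b))"
begin

lemma gr_charfun_zero:
  assumes "0 < N"
  shows "gr_charfun a b f N 0 t = full 1 0"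
proof -
  have "esum 1 (0 + 1) (\<lambda>es. cis (s * lin 0 (1 # es))) = full 1 0"
    "esum (-1) (0 - 1) (\<lambda>es. cis (s * lin 0 (-1 # es))) = full 1 0"
    using esum_zero_Cons[of 1] esum_zero_Cons[of "-1"] full_0[of 1] assms by simp_all
  from gr_charfun_first_step[of 0 t, folded param, unfolded this] assms show ?thesis by simp
qed

lemma gr_charfun_pos:
  assumes "0 < m" "m < int N"
  shows "gr_charfun a b f N m t =
    (z * hit 1 (m + 1) + no_hit 1 (m + 1) + (z * hit (-1) (m - 1) + no_hit (-1) (m - 1))) / 2"
  using gr_charfun_first_step[of m t, folded param] esum_lin_Cons[of m 1] esum_lin_Cons[of m "-1"] assms
  by simp

end

end

theorem theorem2:
  fixes a b \<eta> :: real and f :: "nat \<Rightarrow> nat" and m :: int and t :: real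
  assumes "0 < a" "a < 1" "0 < b" "b < 1" "0 < \<eta>" "\<eta> < 1"
    and "\<And>N. N \<ge> 2 \<Longrightarrow> 1 \<le> f N \<and> f N < N"
    and "(\<lambda>N. real (f N)) \<sim>[at_top] (\<lambda>N. \<eta> * real N)"
  shows "(\<lambda>N. gr_charfun a b (f N) N m t) \<longlonglongrightarrow> psi_hat a b \<eta> t / phi_hat a b \<eta> t"
proof -
  note ab = assms(1-4) and \<eta> = assms(5,6) and f = assms(7)
  have f': "\<forall>N\<ge>2. 1 \<le> f N \<and> f N < N" using f by blast
  have lim: "(\<lambda>N. real (f N) / real N) \<longlonglongrightarrow> \<eta>"
  proof -
    have "(\<lambda>N. real (f N) / (\<eta> * real N)) \<longlonglongrightarrow> 1"
    proof (rule asymp_equivD_strong[OF assms(8)])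
      show "\<forall>\<^sub>F N in at_top. real (f N) \<noteq> 0 \<or> \<eta> * real N \<noteq> 0"
        using eventually_gt_at_top[of 0] by eventually_elim (use \<eta> in simp)
    qed
    from tendsto_mult_left[OF this, of \<eta>] show ?thesis using \<eta> by simp
  qed
  define r bt g where "r = (2 - a - b) / ((1 - a) * (1 - b))" and "bt = 1 / ((1 - a) * (1 - b))"
    and "g = a * (b - a) / ((1 - a) * (1 - b))"
  let ?F = "\<lambda>N. ruin_weight.full a b (f N) N (t / real N) r bt g 1 0"
  let ?l = "psi_hat a b \<eta> t / phi_hat a b \<eta> t"
  note psi = psi_phi_eq[OF ab \<eta>, of t, folded r_def bt_def kap_def]
  have F: "?F \<longlonglongrightarrow> ?l"
    using full_tendsto[OF ab f' lim \<eta>, folded r_def bt_def g_def, OF psi(1,2) refl psi(3)]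
    unfolding psi(4) by simp
  have rw: "ruin_weight a b" and ru: "ruin a b" using ab by unfold_locales
  let ?hit = "\<lambda>N. ruin_weight.hit a b (f N) N (t / real N) r bt g" and ?no = "\<lambda>N. ruin.no_hit a b (f N) N"
  have "(\<lambda>N. gr_charfun a b (f N) N (int k) t) \<longlonglongrightarrow> ?l" for k
  proof (cases k)
    case 0
    show ?thesis
    proof (rule Lim_transform_eventually[OF F], intro eventually_sequentiallyI[of 1])
      fix N :: nat assume N: "1 \<le> N"
      show "?F N = gr_charfun a b (f N) N (int k) t"
        using ruin_weight.gr_charfun_zero[OF rw refl r_def bt_def g_def, of N "f N"] N 0 by simp
    qed
  next
    case (Suc k')
    have f_large: "\<forall>\<^sub>F N in sequentially. K < f N" for K
    proof -
      have "filterlim (\<lambda>N. real (f N) / real N * real N) at_top sequentially"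
        using \<eta> by (intro filterlim_tendsto_pos_mult_at_top[OF lim] filterlim_real_sequentially)
      then have "\<forall>\<^sub>F N in sequentially. real K < real (f N) / real N * real N"
        by (auto simp: filterlim_at_top_dense)
      then show ?thesis using eventually_gt_at_top[of 0] by eventually_elim simp
    qed
    have z: "(\<lambda>N. cis (t / real N)) \<longlonglongrightarrow> 1" by (rule expands_tendsto[OF expands_cis])
    \<comment> \<open>Both sequences are indexed by the edge {j, j + 1}. With this indexing
      \<open>q N 0\<close> is the value at 0 itself, to which all other levels are compared.\<close>
    define p where "p N j = ?hit N 1 (int j + 1)" for N j
    define q where "q N j = ?hit N (-1) (int j)" for N j
    have pn: "norm (p N j) \<le> 1" "norm (q N j) \<le> 1" for N j
      unfolding p_def q_def by (intro ruin_weight.norm_hit_le[OF rw], simp)+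
    have rec: "\<forall>\<^sub>F N in sequentially.
        p N j = of_real a * cis (t / real N) * p N (Suc j) + of_real (1 - a) * cis (t / real N) * q N j
      \<and> q N (Suc j) = of_real (1 - a) * cis (t / real N) * p N (Suc j) + of_real a * cis (t / real N) * q N j" for j
      using f_large[of "Suc j"] eventually_ge_at_top[of 2]
    proof eventually_elim
      case (elim N)
      then have "Suc j < f N" "Suc j < N" using f[of N] by auto
      from ruin_weight.hit_rec[OF rw this, of "t / real N" r bt g] show ?case
        by (simp add: p_def q_def ruin_weight.z_def[OF rw])
    qed
    note lims = bounded_recursion_tendsto[where p = p and q = q, OF z ab(1,2) pn rec]
    have q0: "q N 0 = ?F N" if "1 \<le> N" for N
      using ruin_weight.hit_0_eq[OF rw, of N] that by (simp add: q_def)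
    have Q0: "(\<lambda>N. q N 0) \<longlonglongrightarrow> ?l"
      by (rule Lim_transform_eventually[OF F], intro eventually_sequentiallyI[of 1]) (simp add: q0)
    have pq: "(\<lambda>N. p N j) \<longlonglongrightarrow> ?l" "(\<lambda>N. q N j) \<longlonglongrightarrow> ?l" for j
      using tendsto_add[OF lims(1)[of j] Q0] tendsto_add[OF lims(2)[of j] Q0] by simp_all
    have Z: "(\<lambda>N. ?no N 1 1) \<longlonglongrightarrow> 0"
      by (rule tendsto_of_scaled) (use no_hit_scaled_tendsto[OF ab f' lim \<eta>] in simp)
    have no: "(\<lambda>N. ?no N 1 (int j + 1)) \<longlonglongrightarrow> 0" "(\<lambda>N. ?no N (-1) (int j)) \<longlonglongrightarrow> 0" for j
    proof -
      define K where "K = 1 + real j * ((1 - a) / a + (1 - b) / b)"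
      have B: "(\<lambda>N. K * norm (?no N 1 1)) \<longlonglongrightarrow> 0" "(\<lambda>N. (K + 1) * norm (?no N 1 1)) \<longlonglongrightarrow> 0"
        using tendsto_mult_left[OF tendsto_norm_zero[OF Z]] by auto
      show "(\<lambda>N. ?no N 1 (int j + 1)) \<longlonglongrightarrow> 0"
        by (rule Lim_null_comparison[OF _ B(1)], intro eventually_sequentiallyI[of "Suc j"])
          (auto simp: K_def intro!: ruin.norm_no_hit_le[OF ru])
      show "(\<lambda>N. ?no N (-1) (int j)) \<longlonglongrightarrow> 0"
        by (rule Lim_null_comparison[OF _ B(2)], intro eventually_sequentiallyI[of "Suc j"])
          (use ruin.norm_no_hit_le(2)[OF ru, of j] in \<open>auto simp: K_def\<close>)
    qed
    have "(\<lambda>N. (cis (t / real N) * p N k + ?no N 1 (int k + 1)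
        + (cis (t / real N) * q N k' + ?no N (-1) (int k'))) / 2) \<longlonglongrightarrow> (1 * ?l + 0 + (1 * ?l + 0)) / 2"
      by (intro tendsto_intros z pq no) simp
    then have "(\<lambda>N. (cis (t / real N) * p N k + ?no N 1 (int k + 1)
        + (cis (t / real N) * q N k' + ?no N (-1) (int k'))) / 2) \<longlonglongrightarrow> ?l" by simp
    then show ?thesis
    proof (rule Lim_transform_eventually, intro eventually_sequentiallyI[of "Suc k"])
      fix N assume N: "Suc k \<le> N"
      show "(cis (t / real N) * p N k + ?no N 1 (int k + 1)
        + (cis (t / real N) * q N k' + ?no N (-1) (int k'))) / 2 = gr_charfun a b (f N) N (int k) t"
        using ruin_weight.gr_charfun_pos[OF rw refl r_def bt_def g_def, of "int k" N "f N"] N Suc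
        by (simp add: p_def q_def ruin_weight.z_def[OF rw])
    qed
  qed
  from this[of "nat \<bar>m\<bar>"] show ?thesis
    by (cases "0 \<le> m") (simp_all add: gr_charfun_uminus)
qed

end
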